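(* Let $N\ge 1$. If the linear operator $\Phi:T(M)\to T(M)$ is hereditary, then the operator $\hat{\Phi}_N:T(\hat{M}_N)\to T(\hat{M}_N)$ defined by the lower-triangular block matrix $$\hat{\Phi}_N(\hat{\eta}_N)=\left[\frac{1}{(i-j)!}\left.\frac{\partial^{i-j}\Phi(\hat u_N)}{\partial\varepsilon^{i-j}}\right|_{\varepsilon=0}\right]_{i,j=0,1,\dots,N},$$ where blocks with $i<j$ are zero (so the diagonal blocks are $\Phi(\eta_0)$) and $\hat u_N=\sum_{i=0}^N\varepsilon^i\eta_i$, is hereditary too.
   Context: Setting. $M=M(u)$ is a manifold with variable $u$, a column vector with $q$ components (typically functions); it is treated as a linear space, so that $u+\varepsilon S$ makes sense and tangent vectors at all points lie in one fixed space $E$. $\hat M_N=\hat M_N(\hat\eta_N)$ is the analogous manifold with variable $\hat\eta_N=(\eta_0^T,\eta_1^T,\dots,\eta_N^T)^T$, each $\eta_i$ being a column vector of the same kind and dimension as $u$; its tangent vectors are $(N+1)$-tuples of elements of $E$, and operators on them are $(N+1)\times(N+1)$ block matrices of operators on $E$. $T(M)$, $T(\hat M_N)$ denote tangent bundles, and $K\in T(M)$ means that $K$ is a vector field $u\mapsto K(u)$. A linear operator $\Phi:T(M)\to T(M)$ assigns to each $u$ a linear map $\Phi(u)$ of tangent vectors. All objects are assumed smooth, with as many derivatives as needed. Gateaux derivative: $X'(u)[S(u)]=\left.\frac{\partial}{\partial\varepsilon}X(u+\varepsilon S(u))\right|_{\varepsilon=0}$ for a tensor field or operator $X$ and a vector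 field $S$. A linear operator $\Phi:T(M)\to T(M)$ is hereditary if for all vector fields $K,S\in T(M)$ and all $u$, $$\Phi'(u)[\Phi(u)K(u)]S(u)-\Phi(u)\Phi'(u)[K(u)]S(u)-\Phi'(u)[\Phi(u)S(u)]K(u)+\Phi(u)\Phi'(u)[S(u)]K(u)=0.$$ The same definition applies on $\hat M_N$. *)

theory Defs
  imports "HOL-Analysis.Analysis"
begin

text \<open>
  The points \<open>u\<close> are typically columns of functions, and the operators typically
  contain differentiations, so a normed model space would exclude the intended examples.  The
  model space is therefore an arbitrary Hausdorff locally convex real vector space, and
  smoothness is understood in the sense of Michal and Bastiani (equivalently, of Hamilton's
  calculus on Frechet spaces): all iterated Gateaux derivatives exist and are jointly continuous.
\<close>

class locally_convex_space = real_vector + topological_ab_group_add + t2_space +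
  assumes tendsto_scaleR_nhds:
      "((\<lambda>p. fst p *\<^sub>R snd p) \<longlongrightarrow> r *\<^sub>R x) (nhds r \<times>\<^sub>F nhds x)"
    and convex_neighbourhood:
      "open U \<Longrightarrow> 0 \<in> U \<Longrightarrow> \<exists>V. open V \<and> 0 \<in> V \<and> V \<subseteq> U \<and>
        (\<forall>x\<in>V. \<forall>y\<in>V. \<forall>a\<ge>0. \<forall>b\<ge>0. a + b = 1 \<longrightarrow> a *\<^sub>R x + b *\<^sub>R y \<in> V)"

text \<open>The last condition is \<^term>\<open>convex V\<close>, which the class specification cannot mention.\<close>

lemma convex_neighbourhood':
  fixes U :: "'a::locally_convex_space set"
  assumes "open U" "0 \<in> U"
  shows "\<exists>V. open V \<and> 0 \<in> V \<and> convex V \<and> V \<subseteq> U"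
  using convex_neighbourhood[OF assms] unfolding convex_def by blast

instance vec :: (t0_space, finite) t0_space
proof
  fix x y :: "'a ^ 'b"
  assume "x \<noteq> y"
  then obtain i where i: "x $ i \<noteq> y $ i" by (auto simp: vec_eq_iff)
  then obtain U where "open U" "(x $ i \<in> U) \<noteq> (y $ i \<in> U)"
    using t0_space_class.t0_space[OF i] by auto
  then show "\<exists>U. open U \<and> \<not> (x \<in> U \<longleftrightarrow> y \<in> U)"
    by (intro exI[of _ "(\<lambda>z. z $ i) -` U"]) (auto simp: open_vimage_vec_nth)
qed

instance vec :: (t1_space, finite) t1_space
proof
  fix x y :: "'a ^ 'b"
  assume "x \<noteq> y"
  then obtain i where i: "x $ i \<noteq> y $ i" by (auto simp: vec_eq_iff)
  then obtain U where "open U" "x $ i \<in> U" "y $ i \<notin> U"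
    using t1_space_class.t1_space[OF i] by auto
  then show "\<exists>U. open U \<and> x \<in> U \<and> y \<notin> U"
    by (intro exI[of _ "(\<lambda>z. z $ i) -` U"]) (auto simp: open_vimage_vec_nth)
qed

instance vec :: (t2_space, finite) t2_space
proof
  fix x y :: "'a ^ 'b"
  assume "x \<noteq> y"
  then obtain i where i: "x $ i \<noteq> y $ i" by (auto simp: vec_eq_iff)
  then obtain U V where UV: "open U" "open V" "x $ i \<in> U" "y $ i \<in> V" "U \<inter> V = {}"
    using hausdorff[OF i] by auto
  have "open ((\<lambda>z :: 'a ^ 'b. z $ i) -` U)" "open ((\<lambda>z :: 'a ^ 'b. z $ i) -` V)"
    using UV by (simp_all add: open_vimage_vec_nth)
  then show "\<exists>U V. open U \<and> open V \<and> x \<in> U \<and> y \<in> V \<and> U \<inter> V = {}"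
    using UV by (intro exI[of _ "(\<lambda>z. z $ i) -` U"] exI[of _ "(\<lambda>z. z $ i) -` V"]) auto
qed

section \<open>Gateaux derivatives and smooth maps\<close>

definition diff_quotient :: "(real \<Rightarrow> 'b::real_vector) \<Rightarrow> real \<Rightarrow> real \<Rightarrow> 'b" where
  "diff_quotient c t h = (1 / h) *\<^sub>R (c (t + h) - c t)"

text \<open>Library derivatives of curves require a normed codomain.\<close>

definition curve_differentiable :: "(real \<Rightarrow> 'b::{real_vector,t2_space}) \<Rightarrow> real \<Rightarrow> bool" where
  "curve_differentiable c t \<longleftrightarrow> (\<exists>d. (diff_quotient c t \<longlongrightarrow> d) (at 0))"

definition curve_deriv :: "(real \<Rightarrow> 'b::{real_vector,t2_space}) \<Rightarrow> real \<Rightarrow> 'b" where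
  "curve_deriv c t = Lim (at 0) (diff_quotient c t)"

definition gateaux_differentiable ::
    "('a::real_vector \<Rightarrow> 'b::{real_vector,t2_space}) \<Rightarrow> 'a \<Rightarrow> 'a \<Rightarrow> bool" where
  "gateaux_differentiable X u v \<longleftrightarrow> curve_differentiable (\<lambda>\<epsilon>. X (u + \<epsilon> *\<^sub>R v)) 0"

definition gateaux_deriv ::
    "('a::real_vector \<Rightarrow> 'b::{real_vector,t2_space}) \<Rightarrow> 'a \<Rightarrow> 'a \<Rightarrow> 'b" where
  "gateaux_deriv X u v = curve_deriv (\<lambda>\<epsilon>. X (u + \<epsilon> *\<^sub>R v)) 0"

text \<open>
  \<open>iter_gateaux X k v u\<close> is the \<open>k\<close>-th derivative of \<open>X\<close> at \<open>u\<close> in the successive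
  constant directions \<open>v 0, \<dots>, v (k - 1)\<close>; the other values of \<open>v\<close> are irrelevant.
\<close>

primrec iter_gateaux ::
    "('a::real_vector \<Rightarrow> 'b::{real_vector,t2_space}) \<Rightarrow> nat \<Rightarrow> (nat \<Rightarrow> 'a) \<Rightarrow> 'a \<Rightarrow> 'b" where
  "iter_gateaux X 0 v = X"
| "iter_gateaux X (Suc k) v = (\<lambda>u. gateaux_deriv (iter_gateaux X k v) u (v k))"

text \<open>
  \<open>nat \<Rightarrow> 'a\<close> carries the product topology, so the continuity condition is joint
  continuity in the point and in the \<open>k\<close> directions.
\<close>

definition smooth ::
    "('a::{real_vector,topological_space} \<Rightarrow> 'b::{real_vector,t2_space}) \<Rightarrow> bool" where
  "smooth X \<longleftrightarrow>
     (\<forall>k. (\<forall>v u. gateaux_differentiable (iter_gateaux X k v) u (v k)) \<and>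
          continuous_on UNIV (\<lambda>(u, v). iter_gateaux X k v u))"

section \<open>Operator fields and heredity\<close>

text \<open>
  \<open>\<Phi> u w\<close> is \<open>\<Phi>(u)w\<close>.  Vector fields are maps \<open>'a \<Rightarrow> 'a\<close>, as all tangent spaces
  are identified with \<open>'a\<close>.
\<close>

definition linear_operator_field ::
    "('a::{real_vector,t2_space} \<Rightarrow> 'a \<Rightarrow> 'a) \<Rightarrow> bool" where
  "linear_operator_field \<Phi> \<longleftrightarrow> (\<forall>u. linear (\<Phi> u)) \<and> smooth (\<lambda>(u, w). \<Phi> u w)"

text \<open>\<open>operator_deriv \<Phi> u v w\<close> is \<open>\<Phi>'(u)[v]w\<close>; operators are differentiated pointwise.\<close>

definition operator_deriv ::
    "('a::{real_vector,t2_space} \<Rightarrow> 'a \<Rightarrow> 'a) \<Rightarrow> 'a \<Rightarrow> 'a \<Rightarrow> 'a \<Rightarrow> 'a" where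
  "operator_deriv \<Phi> u v w = gateaux_deriv (\<lambda>x. \<Phi> x w) u v"

definition hereditary :: "('a::{real_vector,t2_space} \<Rightarrow> 'a \<Rightarrow> 'a) \<Rightarrow> bool" where
  "hereditary \<Phi> \<longleftrightarrow> linear_operator_field \<Phi> \<and>
     (\<forall>K S. smooth K \<longrightarrow> smooth S \<longrightarrow>
       (\<forall>u. operator_deriv \<Phi> u (\<Phi> u (K u)) (S u)
            - \<Phi> u (operator_deriv \<Phi> u (K u) (S u))
            - operator_deriv \<Phi> u (\<Phi> u (S u)) (K u)
            + \<Phi> u (operator_deriv \<Phi> u (S u) (K u)) = 0))"

section \<open>The perturbation operator\<close>

text \<open>
  A point \<open>(\<eta>\<^sub>0, \<dots>, \<eta>\<^sub>N)\<close>, or a tangent vector, of the perturbed manifold is an element of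
  \<open>'a ^ 'n\<close>, where \<open>ix\<close> is a bijection from the index type \<open>'n\<close> onto \<open>{0..N}\<close>: the
  component of \<open>\<eta>\<close> at \<open>k\<close> is \<open>\<eta>\<^sub>i\<close> with \<open>i = ix k\<close>.
\<close>

definition perturbed_point ::
    "('n::finite \<Rightarrow> nat) \<Rightarrow> ('a::real_vector) ^ 'n \<Rightarrow> real \<Rightarrow> 'a" where
  "perturbed_point ix \<eta> \<epsilon> = (\<Sum>k\<in>UNIV. \<epsilon> ^ ix k *\<^sub>R (\<eta> $ k))"

definition perturbation_block ::
    "('n::finite \<Rightarrow> nat) \<Rightarrow> ('a::{real_vector,t2_space} \<Rightarrow> 'a \<Rightarrow> 'a) \<Rightarrow>
      'a ^ 'n \<Rightarrow> 'n \<Rightarrow> 'n \<Rightarrow> 'a \<Rightarrow> 'a" where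
  "perturbation_block ix \<Phi> \<eta> k l w =
     (if ix k < ix l then 0
      else (1 / fact (ix k - ix l)) *\<^sub>R
        (curve_deriv ^^ (ix k - ix l)) (\<lambda>\<epsilon>. \<Phi> (perturbed_point ix \<eta> \<epsilon>) w) 0)"

definition perturbation_operator ::
    "('n::finite \<Rightarrow> nat) \<Rightarrow> ('a::{real_vector,t2_space} \<Rightarrow> 'a \<Rightarrow> 'a) \<Rightarrow>
      'a ^ 'n \<Rightarrow> 'a ^ 'n \<Rightarrow> 'a ^ 'n" where
  "perturbation_operator ix \<Phi> \<eta> W =
     (\<chi> k. \<Sum>l\<in>UNIV. perturbation_block ix \<Phi> \<eta> k l (W $ l))"

end

theory Submission
  imports Defs
begin

text \<open>
  The perturbation operator is the jet prolongation of \<open>\<Phi>\<close>: up to order \<open>N\<close>, its value at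
  \<open>\<eta>\<close> and \<open>W\<close> collects the Taylor coefficients at \<open>\<epsilon> = 0\<close> of \<open>\<Phi>(u(\<epsilon>)) w(\<epsilon>)\<close>, where
  \<open>u\<close> and \<open>w\<close> are the polynomial curves with coefficients \<open>\<eta>\<close> and \<open>W\<close>.  By the Leibniz
  rule these coefficients depend only on the Taylor coefficients of \<open>w\<close> up to order \<open>N\<close>, and by
  the symmetry of higher derivatives the same description holds for the derivative of the
  perturbation operator, with \<open>\<Phi>'(u(\<epsilon>))[v(\<epsilon>)] w(\<epsilon>)\<close>.  Hence the heredity expression of the
  perturbation operator consists of Taylor coefficients of the heredity expression of \<open>\<Phi>\<close> along
  \<open>u(\<epsilon>)\<close>, which vanishes.
\<close>

section \<open>Locally convex spaces\<close>

text \<open>Most of the work is calculus. The model space carries neither a norm nor completeness,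
  so operator norms, Frechet derivatives and integrals are not at hand. The substitute is a mean
  value statement for convex open sets: if all derivatives along a segment lie in such a set, then
  so does the difference quotient. The chain rule, additivity in the direction and the symmetry of
  second derivatives all come from it.

  A second obstacle is that heredity includes smoothness, so the perturbation operator itself has to
  be shown smooth, which calls for closure of smooth maps under composition. To avoid
  differentiating operator-valued maps, the point \<eta>, a direction, an argument, \<epsilon> and
  one further real parameter are made coordinates of a single smooth map,
  \<open>perturbed_operator\<close>. Taylor coefficients in \<epsilon>, derivatives in \<eta> and
  the operator derivative of \<Phi> are then all read off from its iterated Gateaux derivatives in
  fixed coordinate directions.\<close>

lemma tendsto_fst_nhds: "(fst \<longlongrightarrow> a) (nhds (a, b))"
  using tendsto_fst[OF filterlim_ident, of "(a, b)"] by simp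

lemma tendsto_snd_nhds: "(snd \<longlongrightarrow> b) (nhds (a, b))"
  using tendsto_snd[OF filterlim_ident, of "(a, b)"] by simp

text \<open>The parameters of a curve are later coordinates of the domain of a smooth map, so the
  reals must belong to the class.\<close>

instance real :: locally_convex_space
proof
  show "((\<lambda>p. fst p *\<^sub>R snd p) \<longlongrightarrow> r *\<^sub>R x) (nhds r \<times>\<^sub>F nhds x)" for r x :: real
    unfolding nhds_prod[symmetric] by (intro tendsto_intros tendsto_fst_nhds tendsto_snd_nhds)
next
  fix U :: "real set"
  assume "open U" "0 \<in> U"
  then obtain e where e: "e > 0" "ball 0 e \<subseteq> U"
    by (auto simp: open_contains_ball)
  show "\<exists>V. open V \<and> 0 \<in> V \<and> V \<subseteq> U \<and>
      (\<forall>x\<in>V. \<forall>y\<in>V. \<forall>a\<ge>0. \<forall>b\<ge>0. a + b = 1 \<longrightarrow> a *\<^sub>R x + b *\<^sub>R y \<in> V)"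
    using e convex_ball[of "0::real" e] unfolding convex_def
    by (intro exI[of _ "ball 0 e"]) auto
qed

lemma lc_tendsto_scaleR:
  fixes g :: "'b \<Rightarrow> 'a::locally_convex_space"
  assumes "(f \<longlongrightarrow> r) F" "(g \<longlongrightarrow> x) F"
  shows "((\<lambda>t. f t *\<^sub>R g t) \<longlongrightarrow> r *\<^sub>R x) F"
  using filterlim_compose[OF tendsto_scaleR_nhds, of "\<lambda>t. (f t, g t)" r x F]
  by (simp add: nhds_prod[symmetric] tendsto_Pair assms)

lemma lc_continuous_on_scaleR:
  fixes g :: "'b::topological_space \<Rightarrow> 'a::locally_convex_space"
  assumes "continuous_on S f" "continuous_on S g"
  shows "continuous_on S (\<lambda>x. f x *\<^sub>R g x)"
  using assms unfolding continuous_on_def by (blast intro: lc_tendsto_scaleR)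

section \<open>Products and finite powers of locally convex spaces\<close>

instance prod :: (topological_monoid_add, topological_monoid_add) topological_monoid_add
proof
  fix a b :: "'a \<times> 'b"
  show "((\<lambda>p. fst p + snd p) \<longlongrightarrow> a + b) (nhds a \<times>\<^sub>F nhds b)"
    unfolding nhds_prod[symmetric] plus_prod_def
    by (intro tendsto_intros tendsto_fst_nhds tendsto_snd_nhds)
qed

instance prod :: (topological_group_add, topological_group_add) topological_group_add
proof
  fix a :: "'a \<times> 'b"
  show "(uminus \<longlongrightarrow> - a) (nhds a)"
    unfolding uminus_prod_def by (intro tendsto_intros filterlim_ident)
qed

instance prod :: (topological_ab_group_add, topological_ab_group_add) topological_ab_group_add ..

instance prod :: (locally_convex_space, locally_convex_space) locally_convex_space
proof
  show "((\<lambda>p. fst p *\<^sub>R snd p) \<longlongrightarrow> r *\<^sub>R x) (nhds r \<times>\<^sub>F nhds x)" for r and x :: "'a \<times> 'b"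
    unfolding nhds_prod[symmetric] scaleR_prod_def
    by (intro tendsto_intros tendsto_fst_nhds tendsto_snd_nhds lc_tendsto_scaleR)
next
  fix U :: "('a \<times> 'b) set"
  assume "open U" "0 \<in> U"
  then obtain A B where AB: "open A" "open B" "0 \<in> A" "0 \<in> B" "A \<times> B \<subseteq> U"
    by (force simp: open_prod_def zero_prod_def)
  obtain V W where V: "open V" "0 \<in> V" "convex V" "V \<subseteq> A"
    and W: "open W" "0 \<in> W" "convex W" "W \<subseteq> B"
    using AB convex_neighbourhood' by metis
  show "\<exists>V. open V \<and> 0 \<in> V \<and> V \<subseteq> U \<and>
      (\<forall>x\<in>V. \<forall>y\<in>V. \<forall>a\<ge>0. \<forall>b\<ge>0. a + b = 1 \<longrightarrow> a *\<^sub>R x + b *\<^sub>R y \<in> V)"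
    using V W AB unfolding convex_def
    by (intro exI[of _ "V \<times> W"]) (auto simp: zero_prod_def open_Times)
qed

instance vec :: (topological_monoid_add, finite) topological_monoid_add
proof
  fix a b :: "'a ^ 'b"
  show "((\<lambda>p. fst p + snd p) \<longlongrightarrow> a + b) (nhds a \<times>\<^sub>F nhds b)"
    unfolding nhds_prod[symmetric] plus_vec_def
    by (intro tendsto_intros tendsto_fst_nhds tendsto_snd_nhds)
qed

instance vec :: (topological_group_add, finite) topological_group_add
proof
  fix a :: "'a ^ 'b"
  show "(uminus \<longlongrightarrow> - a) (nhds a)"
    unfolding uminus_vec_def by (intro tendsto_intros filterlim_ident)
qed

instance vec :: (topological_ab_group_add, finite) topological_ab_group_add ..

instance vec :: (locally_convex_space, finite) locally_convex_space
proof
  show "((\<lambda>p. fst p *\<^sub>R snd p) \<longlongrightarrow> r *\<^sub>R x) (nhds r \<times>\<^sub>F nhds x)" for r and x :: "'a ^ 'b"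
    unfolding nhds_prod[symmetric] scaleR_vec_def
    by (intro tendsto_intros tendsto_fst_nhds tendsto_snd_nhds lc_tendsto_scaleR)
next
  fix U :: "('a ^ 'b) set"
  assume "open U" "0 \<in> U"
  then obtain A where A: "\<And>i. open (A i)" "\<And>i. 0 \<in> A i" "\<And>y. \<forall>i. y $ i \<in> A i \<Longrightarrow> y \<in> U"
    unfolding open_vec_def by (metis zero_index)
  have "\<forall>i. \<exists>V. open V \<and> 0 \<in> V \<and> convex V \<and> V \<subseteq> A i"
    using convex_neighbourhood'[OF A(1,2)] by blast
  then obtain V where V: "\<And>i. open (V i)" "\<And>i. 0 \<in> V i" "\<And>i. convex (V i)" "\<And>i. V i \<subseteq> A i"
    by metis
  have "open {y. \<forall>i. y $ i \<in> V i}"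
    unfolding open_vec_def using V(1) by (auto intro!: exI[of _ V])
  then show "\<exists>V. open V \<and> 0 \<in> V \<and> V \<subseteq> U \<and>
      (\<forall>x\<in>V. \<forall>y\<in>V. \<forall>a\<ge>0. \<forall>b\<ge>0. a + b = 1 \<longrightarrow> a *\<^sub>R x + b *\<^sub>R y \<in> V)"
  proof (intro exI[of _ "{y. \<forall>i. y $ i \<in> V i}"] conjI)
    show "{y. \<forall>i. y $ i \<in> V i} \<subseteq> U"
      using A(3) V(4) by blast
    show "\<forall>x\<in>{y. \<forall>i. y $ i \<in> V i}. \<forall>y\<in>{y. \<forall>i. y $ i \<in> V i}. \<forall>a\<ge>0. \<forall>b\<ge>0. a + b = 1 \<longrightarrow>
        a *\<^sub>R x + b *\<^sub>R y \<in> {y. \<forall>i. y $ i \<in> V i}"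
      by (auto intro!: convexD[OF V(3)])
  qed (simp_all add: V(2))
qed

lemma lc_convex_neighbourhood:
  fixes x :: "'a::locally_convex_space"
  assumes "open U" "x \<in> U"
  obtains V where "open V" "convex V" "x \<in> V" "V \<subseteq> U"
proof -
  have "open ((\<lambda>y. y + x) -` U)"
    by (intro open_vimage assms continuous_intros)
  then obtain V where V: "open V" "0 \<in> V" "convex V" "V \<subseteq> (\<lambda>y. y + x) -` U"
    using convex_neighbourhood'[of "(\<lambda>y. y + x) -` U"] assms by auto
  \<comment> \<open>Writing the translate as a preimage under a continuous map gives its
    openness.\<close>
  have eq: "(+) x ` V = (\<lambda>y. y + - x) -` V"
    by (force simp: image_iff algebra_simps)
  show ?thesis
  proof
    show "open ((+) x ` V)"
      unfolding eq by (intro open_vimage V continuous_intros)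
    show "convex ((+) x ` V)"
      by (intro convex_translation V)
    show "x \<in> (+) x ` V" "(+) x ` V \<subseteq> U"
      using V by (auto simp: image_iff add.commute)
  qed
qed

lemma tendsto_funI:
  fixes f :: "'a \<Rightarrow> 'b \<Rightarrow> 'c::topological_space"
  assumes "\<And>i. ((\<lambda>x. f x i) \<longlongrightarrow> l i) F"
  shows "(f \<longlongrightarrow> l) F"
proof -
  have "limitin (product_topology (\<lambda>i. euclidean) UNIV) f l F"
    using assms by (subst limitin_componentwise) (auto simp: extensional_def)
  then show ?thesis
    by (simp add: euclidean_product_topology)
qed

section \<open>Derivatives of curves\<close>

definition has_curve_deriv :: "(real \<Rightarrow> 'b::{real_vector,t2_space}) \<Rightarrow> 'b \<Rightarrow> real \<Rightarrow> bool" where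
  "has_curve_deriv c d t \<longleftrightarrow> (diff_quotient c t \<longlongrightarrow> d) (at 0)"

lemma curve_deriv_eqI: "has_curve_deriv c d t \<Longrightarrow> curve_deriv c t = d"
  unfolding has_curve_deriv_def curve_deriv_def by (intro tendsto_Lim) auto

lemma curve_differentiableI: "has_curve_deriv c d t \<Longrightarrow> curve_differentiable c t"
  unfolding has_curve_deriv_def curve_differentiable_def by blast

lemma curve_differentiableD:
  "curve_differentiable c t \<Longrightarrow> has_curve_deriv c (curve_deriv c t) t"
  using curve_deriv_eqI[of c _ t]
  unfolding curve_differentiable_def has_curve_deriv_def[symmetric] by auto

lemma has_curve_deriv_const: "has_curve_deriv (\<lambda>_. x) 0 t"
  by (simp add: has_curve_deriv_def diff_quotient_def[abs_def])

lemma has_curve_deriv_add: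
  fixes c d :: "real \<Rightarrow> 'b::locally_convex_space"
  assumes "has_curve_deriv c c' t" "has_curve_deriv d d' t"
  shows "has_curve_deriv (\<lambda>s. c s + d s) (c' + d') t"
  using tendsto_add[OF assms[unfolded has_curve_deriv_def]]
  by (simp add: has_curve_deriv_def diff_quotient_def[abs_def] algebra_simps)

lemma has_curve_deriv_linear:
  fixes c :: "real \<Rightarrow> 'b::locally_convex_space" and f :: "'b \<Rightarrow> 'c::locally_convex_space"
  assumes "linear f" "continuous_on UNIV f" "has_curve_deriv c d t"
  shows "has_curve_deriv (\<lambda>s. f (c s)) (f d) t"
proof -
  have "((\<lambda>h. f (diff_quotient c t h)) \<longlongrightarrow> f d) (at 0)"
    using continuous_on_tendsto_compose[OF assms(2) assms(3)[unfolded has_curve_deriv_def]] by simp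
  then show ?thesis
    by (simp add: has_curve_deriv_def diff_quotient_def[abs_def] linear_diff[OF assms(1)]
        linear_scale[OF assms(1)])
qed

lemma has_curve_deriv_scaleR_right:
  fixes c :: "real \<Rightarrow> 'b::locally_convex_space"
  assumes "has_curve_deriv c d t"
  shows "has_curve_deriv (\<lambda>s. r *\<^sub>R c s) (r *\<^sub>R d) t"
  using lc_tendsto_scaleR[OF tendsto_const[of r] assms[unfolded has_curve_deriv_def]]
  by (simp add: has_curve_deriv_def diff_quotient_def[abs_def] algebra_simps)

lemma has_curve_deriv_sum:
  fixes c :: "'i \<Rightarrow> real \<Rightarrow> 'b::locally_convex_space"
  assumes "\<And>i. i \<in> I \<Longrightarrow> has_curve_deriv (c i) (d i) t"
  shows "has_curve_deriv (\<lambda>s. \<Sum>i\<in>I. c i s) (\<Sum>i\<in>I. d i) t"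
  using assms
  by (induction I rule: infinite_finite_induct)
    (auto intro: has_curve_deriv_const has_curve_deriv_add)

text \<open>For \<open>h \<noteq> 0\<close> the value at \<open>t + h\<close> is \<open>c t\<close>
  plus \<open>h\<close> times the difference quotient, and the second term tends to zero.\<close>

lemma has_curve_deriv_tendsto:
  fixes c :: "real \<Rightarrow> 'b::locally_convex_space"
  assumes "has_curve_deriv c d t"
  shows "((\<lambda>h. c (t + h)) \<longlongrightarrow> c t) (at 0)"
proof -
  have "((\<lambda>h. c t + h *\<^sub>R diff_quotient c t h) \<longlongrightarrow> c t + 0 *\<^sub>R d) (at 0)"
    by (intro tendsto_intros lc_tendsto_scaleR assms[unfolded has_curve_deriv_def])
  then have "((\<lambda>h. c t + h *\<^sub>R diff_quotient c t h) \<longlongrightarrow> c t) (at 0)"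
    by simp
  then show ?thesis
    by (rule Lim_transform_eventually) (auto simp: eventually_at_filter diff_quotient_def)
qed

text \<open>Stands in for the fundamental theorem of calculus, as integrals need completeness.\<close>

lemma mean_value_convex:
  fixes c :: "real \<Rightarrow> 'b::locally_convex_space"
  assumes "a \<le> b" and V: "open V" "convex V"
    and deriv: "\<And>t. a \<le> t \<Longrightarrow> t \<le> b \<Longrightarrow> \<exists>d\<in>V. has_curve_deriv c d t"
  shows "\<exists>v\<in>V. c b - c a = (b - a) *\<^sub>R v"
proof -
  \<comment> \<open>Nonnegative combinations of points of a convex set are the total weight times a
    point of the set; when both weights vanish any point serves.\<close>
  have combine: "\<exists>q\<in>V. r *\<^sub>R p1 + s *\<^sub>R p2 = (r + s) *\<^sub>R q"
    if "r \<ge> 0" "s \<ge> 0" "p1 \<in> V" "p2 \<in> V" for r s p1 p2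
  proof (cases "r + s = 0")
    case True
    then have "r = 0" "s = 0" using that by auto
    then show ?thesis using that by (intro bexI[of _ p1]) auto
  next
    case False
    then have "(r / (r + s)) *\<^sub>R p1 + (s / (r + s)) *\<^sub>R p2 \<in> V"
      using that by (intro convexD[OF V(2)]) (auto simp: add_divide_distrib[symmetric])
    then show ?thesis
      using False by (intro bexI) (auto simp: scaleR_add_right)
  qed
  \<comment> \<open>Bisection: the claim passes to unions of adjacent intervals by
    \<open>combine\<close>, and near each point it holds because difference quotients there lie in
    the open set \<open>V\<close>.\<close>
  show ?thesis
    using assms(1)
  proof (induction rule: Bolzano)
    case (trans x y z)
    then obtain v w where vw: "v \<in> V" "c y - c x = (y - x) *\<^sub>R v" "w \<in> V" "c z - c y = (z - y) *\<^sub>R w"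
      by blast
    obtain r where r: "r \<in> V" "(y - x) *\<^sub>R v + (z - y) *\<^sub>R w = ((y - x) + (z - y)) *\<^sub>R r"
      using combine[of "y - x" "z - y" v w] vw trans(3,4) by auto
    have "c z - c x = (c y - c x) + (c z - c y)"
      by simp
    then have "c z - c x = (z - x) *\<^sub>R r"
      unfolding vw r by simp
    then show ?case
      using r(1) by blast
  next
    case (local x)
    then obtain d where d: "d \<in> V" "has_curve_deriv c d x"
      using deriv by blast
    then have "\<forall>\<^sub>F h in at 0. diff_quotient c x h \<in> V"
      using V(1) unfolding has_curve_deriv_def by (auto intro: topological_tendstoD)
    then obtain e where e: "e > 0" "\<And>h. h \<noteq> 0 \<Longrightarrow> \<bar>h\<bar> < e \<Longrightarrow> diff_quotient c x h \<in> V"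
      by (auto simp: eventually_at)
    have near: "\<exists>q\<in>V. c (x + h) - c x = h *\<^sub>R q" if "\<bar>h\<bar> < e" for h
    proof (cases "h = 0")
      case True
      then show ?thesis using d by auto
    next
      case False
      then show ?thesis
        using e(2)[OF False that]
        by (intro bexI[of _ "diff_quotient c x h"]) (auto simp: diff_quotient_def)
    qed
    show ?case
    proof (intro exI[of _ e] conjI allI impI)
      fix y z
      assume yz: "y \<le> x \<and> x \<le> z \<and> z - y < e"
      obtain p q where pq: "p \<in> V" "q \<in> V"
        "c y - c x = (y - x) *\<^sub>R p" "c z - c x = (z - x) *\<^sub>R q"
        using near[of "y - x"] near[of "z - x"] yz by auto
      \<comment> \<open>Splitting at the intermediate point \<open>x\<close> makes both weights
        \<open>z - x\<close> and \<open>x - y\<close> nonnegative.\<close>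
      obtain r where r: "r \<in> V" "(z - x) *\<^sub>R q + (x - y) *\<^sub>R p = ((z - x) + (x - y)) *\<^sub>R r"
        using combine[of "z - x" "x - y" q p] pq yz by auto
      have "c z - c y = (c z - c x) - (c y - c x)"
        by simp
      also have "\<dots> = (z - x) *\<^sub>R q + (x - y) *\<^sub>R p"
        unfolding pq by (simp add: algebra_simps)
      finally show "\<exists>v\<in>V. c z - c y = (z - y) *\<^sub>R v"
        using r by (intro bexI[of _ r]) auto
    qed (use e in auto)
  qed
qed

section \<open>Gateaux derivatives\<close>

definition has_gateaux_deriv ::
    "('a::real_vector \<Rightarrow> 'b::{real_vector,t2_space}) \<Rightarrow> 'b \<Rightarrow> 'a \<Rightarrow> 'a \<Rightarrow> bool" where
  "has_gateaux_deriv X d u v \<longleftrightarrow> has_curve_deriv (\<lambda>\<epsilon>. X (u + \<epsilon> *\<^sub>R v)) d 0"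

lemma gateaux_deriv_eqI: "has_gateaux_deriv X d u v \<Longrightarrow> gateaux_deriv X u v = d"
  unfolding has_gateaux_deriv_def gateaux_deriv_def by (rule curve_deriv_eqI)

lemma has_gateaux_deriv_unique:
  assumes "has_gateaux_deriv X d u v" "has_gateaux_deriv X d' u v"
  shows "d = d'"
  using assms by (auto dest: gateaux_deriv_eqI)

lemma has_gateaux_deriv_iff_tendsto:
  "has_gateaux_deriv X d u v \<longleftrightarrow> ((\<lambda>h. (1 / h) *\<^sub>R (X (u + h *\<^sub>R v) - X u)) \<longlongrightarrow> d) (at 0)"
  by (simp add: has_gateaux_deriv_def has_curve_deriv_def diff_quotient_def[abs_def])

text \<open>Moving the base point along the direction only shifts the parameter. Thus Gateaux
  derivatives at all points of a line are curve derivatives at all parameters, the form that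
  \<open>mean_value_convex\<close> takes.\<close>

lemma has_gateaux_deriv_along:
  "has_gateaux_deriv X d (u + t *\<^sub>R v) v \<longleftrightarrow> has_curve_deriv (\<lambda>\<epsilon>. X (u + \<epsilon> *\<^sub>R v)) d t"
  by (simp add: has_gateaux_deriv_iff_tendsto has_curve_deriv_def diff_quotient_def[abs_def]
      algebra_simps)

lemma has_gateaux_deriv_scaleR_direction:
  fixes X :: "'a::real_vector \<Rightarrow> 'b::locally_convex_space"
  assumes "has_gateaux_deriv X d u v"
  shows "has_gateaux_deriv X (r *\<^sub>R d) u (r *\<^sub>R v)"
proof (cases "r = 0")
  case False
  have "filterlim (\<lambda>h. h * r) (at 0) (at (0::real))"
    using False by (auto simp: filterlim_at eventually_at_filter intro!: tendsto_eq_intros)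
  from filterlim_compose[OF assms[unfolded has_gateaux_deriv_iff_tendsto] this]
  have "((\<lambda>h. r *\<^sub>R (1 / (h * r)) *\<^sub>R (X (u + (h * r) *\<^sub>R v) - X u)) \<longlongrightarrow> r *\<^sub>R d) (at 0)"
    by (intro lc_tendsto_scaleR tendsto_const)
  then show ?thesis
    using False by (simp add: has_gateaux_deriv_iff_tendsto)
qed (simp add: has_gateaux_deriv_def has_curve_deriv_const)

text \<open>The analytic core of the chain rule: both the direction \<open>q h\<close> and a side
  parameter \<open>p h\<close> may vary with the step. By joint continuity the derivatives along the
  segment from \<open>y\<close> to \<open>y + h *\<^sub>R q h\<close> lie in a convex neighbourhood
  of the limit for small \<open>h\<close>, and the mean value statement moves the difference
  quotient there as well.\<close>

lemma partial_chain_tendsto: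
  fixes A :: "'p::topological_space \<Rightarrow> 'b::locally_convex_space \<Rightarrow> 'c::locally_convex_space"
  assumes deriv: "\<And>p y q. has_gateaux_deriv (A p) (A' p y q) y q"
    and cont: "continuous_on UNIV (\<lambda>(p, y, q). A' p y q)"
    and p: "(p \<longlongrightarrow> p0) (at 0)" and q: "(q \<longlongrightarrow> q0) (at 0)"
  shows "((\<lambda>h. (1 / h) *\<^sub>R (A (p h) (y + h *\<^sub>R q h) - A (p h) y)) \<longlongrightarrow> A' p0 y q0) (at 0)"
proof (rule topological_tendstoI)
  fix S
  assume "open S" "A' p0 y q0 \<in> S"
  then obtain V where V: "open V" "convex V" "A' p0 y q0 \<in> V" "V \<subseteq> S"
    by (rule lc_convex_neighbourhood)
  \<comment> \<open>The third argument is the position on the segment; a product neighbourhood of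
    \<open>(p0, q0, 0)\<close> controls parameter, direction and position at once.\<close>
  define g where "g = (\<lambda>(x, z, r). A' x (y + r *\<^sub>R z) z)"
  have "continuous_on UNIV g"
    unfolding g_def case_prod_unfold
    by (rule continuous_on_compose2[OF cont, of _ "\<lambda>x. (fst x, y + snd (snd x) *\<^sub>R fst (snd x), fst (snd x))",
          unfolded case_prod_unfold fst_conv snd_conv])
      (auto intro!: continuous_intros lc_continuous_on_scaleR)
  then have "open (g -` V)"
    by (intro open_vimage V)
  moreover have "(p0, q0, 0) \<in> g -` V"
    using V by (simp add: g_def)
  ultimately obtain B C where BC: "open B" "open C" "(p0, q0, 0) \<in> B \<times> C" "B \<times> C \<subseteq> g -` V"
    by (rule open_prod_elim)
  then have "(q0, 0) \<in> C"
    by simp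
  with BC(2) obtain D E where DE: "open D" "open E" "(q0, 0) \<in> D \<times> E" "D \<times> E \<subseteq> C"
    by (rule open_prod_elim)
  then have "0 \<in> E"
    by simp
  with DE(2) obtain e where e: "e > 0" "ball 0 e \<subseteq> E"
    unfolding open_contains_ball by blast
  have in_V: "A' x (y + r *\<^sub>R z) z \<in> V" if "x \<in> B" "z \<in> D" "\<bar>r\<bar> < e" for x z r
  proof -
    have "r \<in> E"
      using that(3) e(2) by auto
    then have "(x, z, r) \<in> g -` V"
      using that(1,2) BC(4) DE(4) by blast
    then show ?thesis
      by (simp add: g_def)
  qed
  have "\<forall>\<^sub>F h in at 0. p h \<in> B" "\<forall>\<^sub>F h in at 0. q h \<in> D"
    using topological_tendstoD[OF p BC(1)] topological_tendstoD[OF q DE(1)] BC(3) DE(3) by auto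
  moreover have "\<forall>\<^sub>F h in at 0. h \<noteq> 0 \<and> \<bar>h\<bar> < e"
    using e(1) by (auto simp: eventually_at)
  ultimately show "\<forall>\<^sub>F h in at 0. (1 / h) *\<^sub>R (A (p h) (y + h *\<^sub>R q h) - A (p h) y) \<in> S"
  proof eventually_elim
    case (elim h)
    define c where "c r = A (p h) (y + r *\<^sub>R q h)" for r
    have c: "\<exists>d\<in>V. has_curve_deriv c d r" if "\<bar>r\<bar> < e" for r
      unfolding c_def has_gateaux_deriv_along[symmetric]
      using deriv in_V[OF elim(1,2) that] by blast
    \<comment> \<open>The mean value statement needs an ordered interval, so a negative step is
      treated on the interval from \<open>h\<close> to \<open>0\<close>.\<close>
    have "\<exists>v\<in>V. c h - c 0 = h *\<^sub>R v"
    proof (cases "h \<ge> 0")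
      case True
      have "\<exists>v\<in>V. c h - c 0 = (h - 0) *\<^sub>R v"
        by (rule mean_value_convex[OF True V(1,2)]) (intro c, use True elim in linarith)
      then show ?thesis
        by simp
    next
      case False
      have "\<exists>v\<in>V. c 0 - c h = (0 - h) *\<^sub>R v"
        by (rule mean_value_convex[OF _ V(1,2)]) (use False in linarith, intro c, use False elim in linarith)
      then obtain v where "v \<in> V" "c 0 - c h = (0 - h) *\<^sub>R v"
        by blast
      then show ?thesis
        by (intro bexI[of _ v]) (auto simp: algebra_simps)
    qed
    then show ?case
      using elim V(4) by (auto simp: c_def)
  qed
qed

text \<open>Existence of all directional derivatives alone does not give additivity. The increment
  along \<open>v + w\<close> is split at \<open>u + h *\<^sub>R w\<close>; the first part has a base
  point that moves with \<open>h\<close>, which is handled by taking the shift as the parameter of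
  \<open>partial_chain_tendsto\<close>.\<close>

lemma has_gateaux_deriv_add_direction:
  fixes X :: "'a::locally_convex_space \<Rightarrow> 'b::locally_convex_space"
  assumes deriv: "\<And>u v. has_gateaux_deriv X (X' u v) u v"
    and cont: "continuous_on UNIV (\<lambda>(u, v). X' u v)"
  shows "X' u (v + w) = X' u v + X' u w"
proof -
  have 1: "has_gateaux_deriv (\<lambda>y. X (y + p)) (X' (y + p) q) y q" for p y q
    using deriv[of "y + p" q] by (simp add: has_gateaux_deriv_def algebra_simps)
  have 2: "continuous_on UNIV (\<lambda>(p, y, q). X' (y + p) q)"
    unfolding case_prod_unfold
    by (rule continuous_on_compose2[OF cont, of _ "\<lambda>x. (fst (snd x) + fst x, snd (snd x))",
          unfolded case_prod_unfold fst_conv snd_conv])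
      (auto intro!: continuous_intros)
  have "((\<lambda>h. h *\<^sub>R w) \<longlongrightarrow> 0 *\<^sub>R w) (at (0::real))"
    by (intro lc_tendsto_scaleR tendsto_intros)
  then have "((\<lambda>h. (1 / h) *\<^sub>R (X (u + h *\<^sub>R v + h *\<^sub>R w) - X (u + h *\<^sub>R w))) \<longlongrightarrow> X' (u + 0) v) (at 0)"
    by (intro partial_chain_tendsto[OF 1 2]) auto
  moreover have "((\<lambda>h. (1 / h) *\<^sub>R (X (u + h *\<^sub>R w) - X u)) \<longlongrightarrow> X' u w) (at 0)"
    using deriv[of u w] by (simp add: has_gateaux_deriv_iff_tendsto)
  ultimately have "((\<lambda>h. (1 / h) *\<^sub>R (X (u + h *\<^sub>R v + h *\<^sub>R w) - X (u + h *\<^sub>R w)) +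
      (1 / h) *\<^sub>R (X (u + h *\<^sub>R w) - X u)) \<longlongrightarrow> X' u v + X' u w) (at 0)"
    by (auto intro: tendsto_add)
  then have "has_gateaux_deriv X (X' u v + X' u w) u (v + w)"
    by (simp add: has_gateaux_deriv_iff_tendsto algebra_simps)
  with deriv show ?thesis
    by (rule has_gateaux_deriv_unique)
qed

lemma gateaux_deriv_direction_linear:
  fixes X :: "'a::locally_convex_space \<Rightarrow> 'b::locally_convex_space"
  assumes deriv: "\<And>u v. has_gateaux_deriv X (X' u v) u v"
    and cont: "continuous_on UNIV (\<lambda>(u, v). X' u v)"
  shows "linear (X' u)"
proof (rule linearI)
  show "X' u (v + w) = X' u v + X' u w" for v w
    by (rule has_gateaux_deriv_add_direction[OF assms])
  show "X' u (r *\<^sub>R v) = r *\<^sub>R X' u v" for r v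
    by (rule has_gateaux_deriv_unique[OF deriv has_gateaux_deriv_scaleR_direction[OF deriv]])
qed

text \<open>The second difference is \<open>h * h\<close> times a point of a convex neighbourhood of
  the mixed derivative, by one mean value step in direction \<open>b\<close> nested in one in
  direction \<open>a\<close>. The one-sided limit keeps the intervals ordered and still determines
  the value.\<close>

lemma gateaux_second_deriv_tendsto:
  fixes X :: "'a::locally_convex_space \<Rightarrow> 'b::locally_convex_space"
  assumes d1: "\<And>u. has_gateaux_deriv X (X' u) u a"
    and d2: "\<And>u. has_gateaux_deriv X' (X'' u) u b"
    and cont: "continuous_on UNIV X''"
  shows "((\<lambda>h. (1 / (h * h)) *\<^sub>R (X (u + h *\<^sub>R a + h *\<^sub>R b) - X (u + h *\<^sub>R a) - X (u + h *\<^sub>R b) + X u))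
    \<longlongrightarrow> X'' u) (at_right 0)"
proof (rule topological_tendstoI)
  fix S
  assume "open S" "X'' u \<in> S"
  then obtain V where V: "open V" "convex V" "X'' u \<in> V" "V \<subseteq> S"
    by (rule lc_convex_neighbourhood)
  define g where "g = (\<lambda>(r::real, s). X'' (u + r *\<^sub>R a + s *\<^sub>R b))"
  have "continuous_on UNIV g"
    unfolding g_def case_prod_unfold
    by (rule continuous_on_compose2[OF cont]) (auto intro!: continuous_intros lc_continuous_on_scaleR)
  then have "open (g -` V)"
    by (intro open_vimage V)
  moreover have "(0, 0) \<in> g -` V"
    using V by (simp add: g_def)
  ultimately obtain e where e: "e > 0" "ball (0, 0) e \<subseteq> g -` V"
    by (metis open_contains_ball)
  have in_V: "X'' (u + r *\<^sub>R a + s *\<^sub>R b) \<in> V" if "\<bar>r\<bar> < e / 2" "\<bar>s\<bar> < e / 2" for r s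
  proof -
    have "(r, s) \<in> ball (0, 0) e"
      using that sqrt_sum_squares_le_sum_abs[of r s] by (simp add: dist_norm norm_Pair)
    then show ?thesis
      using e(2) by (auto simp: g_def)
  qed
  have "\<forall>\<^sub>F h in at_right 0. 0 < h \<and> h < e / 2"
    using e(1) by (auto simp: eventually_at_right intro!: exI[of _ "e / 2"])
  then show "\<forall>\<^sub>F h in at_right 0. (1 / (h * h)) *\<^sub>R
      (X (u + h *\<^sub>R a + h *\<^sub>R b) - X (u + h *\<^sub>R a) - X (u + h *\<^sub>R b) + X u) \<in> S"
  proof eventually_elim
    case (elim h)
    have inner: "\<exists>v\<in>V. X' (u + r *\<^sub>R a + h *\<^sub>R b) - X' (u + r *\<^sub>R a) = h *\<^sub>R v" if "0 \<le> r" "r \<le> h" for r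
    proof -
      have "\<exists>v\<in>V. X' (u + r *\<^sub>R a + h *\<^sub>R b) - X' (u + r *\<^sub>R a + 0 *\<^sub>R b) = (h - 0) *\<^sub>R v"
      proof (rule mean_value_convex[OF _ V(1,2)])
        fix s assume "0 \<le> s" "s \<le> h"
        then show "\<exists>d\<in>V. has_curve_deriv (\<lambda>s. X' (u + r *\<^sub>R a + s *\<^sub>R b)) d s"
          unfolding has_gateaux_deriv_along[symmetric] using that elim
          by (intro bexI[of _ "X'' (u + r *\<^sub>R a + s *\<^sub>R b)"] d2 in_V) auto
      qed (use elim in auto)
      then show ?thesis by simp
    qed
    \<comment> \<open>The increment in direction \<open>b\<close>, already divided by
      \<open>h\<close>: its derivative along \<open>a\<close> is then exactly the point of
      \<open>V\<close> supplied by \<open>inner\<close>.\<close>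
    define c where "c r = (1 / h) *\<^sub>R (X (u + h *\<^sub>R b + r *\<^sub>R a) + (- 1) *\<^sub>R X (u + r *\<^sub>R a))" for r
    have "\<exists>v\<in>V. c h - c 0 = (h - 0) *\<^sub>R v"
    proof (rule mean_value_convex[OF _ V(1,2)])
      fix r assume r: "0 \<le> r" "r \<le> h"
      obtain v where v: "v \<in> V" "X' (u + r *\<^sub>R a + h *\<^sub>R b) - X' (u + r *\<^sub>R a) = h *\<^sub>R v"
        using inner r by blast
      have "has_curve_deriv c
          ((1 / h) *\<^sub>R (X' (u + h *\<^sub>R b + r *\<^sub>R a) + (- 1) *\<^sub>R X' (u + r *\<^sub>R a))) r"
        unfolding c_def
        by (intro has_curve_deriv_scaleR_right has_curve_deriv_add)
          (use d1 in \<open>simp_all add: has_gateaux_deriv_along[symmetric]\<close>)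
      also have "(1 / h) *\<^sub>R (X' (u + h *\<^sub>R b + r *\<^sub>R a) + (- 1) *\<^sub>R X' (u + r *\<^sub>R a)) = v"
        using v(2) elim by (simp add: algebra_simps)
      finally show "\<exists>d\<in>V. has_curve_deriv c d r"
        using v(1) by blast
    qed (use elim in auto)
    then obtain v where v: "v \<in> V" "c h - c 0 = h *\<^sub>R v"
      by auto
    have "(1 / (h * h)) *\<^sub>R (X (u + h *\<^sub>R a + h *\<^sub>R b) - X (u + h *\<^sub>R a) - X (u + h *\<^sub>R b) + X u)
        = (1 / h) *\<^sub>R (c h - c 0)"
      unfolding c_def by (simp add: algebra_simps)
    also have "\<dots> = v"
      unfolding v using elim by simp
    finally show ?case
      using v V(4) by auto
  qed
qed

text \<open>The second difference is symmetric in \<open>a\<close> and \<open>b\<close>, so both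
  mixed derivatives are limits of the same expression.\<close>

lemma gateaux_deriv_commute_aux:
  fixes X :: "'a::locally_convex_space \<Rightarrow> 'b::locally_convex_space"
  assumes "\<And>u. has_gateaux_deriv X (Xa u) u a" "\<And>u. has_gateaux_deriv Xa (Xab u) u b"
    and "\<And>u. has_gateaux_deriv X (Xb u) u b" "\<And>u. has_gateaux_deriv Xb (Xba u) u a"
    and "continuous_on UNIV Xab" "continuous_on UNIV Xba"
  shows "Xab u = Xba u"
proof -
  have "((\<lambda>h. (1 / (h * h)) *\<^sub>R (X (u + h *\<^sub>R a + h *\<^sub>R b) - X (u + h *\<^sub>R a) - X (u + h *\<^sub>R b) + X u))
    \<longlongrightarrow> Xab u) (at_right 0)"
    by (rule gateaux_second_deriv_tendsto[OF assms(1,2,5)])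
  moreover have "((\<lambda>h. (1 / (h * h)) *\<^sub>R (X (u + h *\<^sub>R a + h *\<^sub>R b) - X (u + h *\<^sub>R a) - X (u + h *\<^sub>R b) + X u))
    \<longlongrightarrow> Xba u) (at_right 0)"
    using gateaux_second_deriv_tendsto[OF assms(3,4,6), of u] by (simp add: algebra_simps)
  ultimately show ?thesis
    by (intro tendsto_unique) auto
qed

section \<open>Iterated derivatives of smooth maps\<close>

lemma iter_gateaux_cong:
  assumes "\<And>i. i < k \<Longrightarrow> v i = w i"
  shows "iter_gateaux X k v = iter_gateaux X k w"
  using assms by (induction k) auto

text \<open>The \<open>k\<close>-th iterate does not read \<open>v k\<close>, so this entry is free
  to hold an arbitrary next direction \<open>q\<close>.\<close>

lemma smooth_iter_deriv:
  assumes "smooth X"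
  shows "has_gateaux_deriv (iter_gateaux X k v) (iter_gateaux X (Suc k) (v(k := q)) u) u q"
proof -
  have "has_gateaux_deriv (iter_gateaux X k (v(k := q)))
      (gateaux_deriv (iter_gateaux X k (v(k := q))) u q) u q"
    using assms unfolding smooth_def gateaux_differentiable_def gateaux_deriv_def has_gateaux_deriv_def
    by (intro curve_differentiableD) (metis fun_upd_same)
  moreover have "iter_gateaux X k (v(k := q)) = iter_gateaux X k v"
    by (rule iter_gateaux_cong) auto
  ultimately show ?thesis
    by simp
qed

lemma smooth_has_gateaux_deriv:
  assumes "smooth X"
  shows "has_gateaux_deriv X (gateaux_deriv X u v) u v"
  using smooth_iter_deriv[OF assms, of 0 "\<lambda>_. v" v u] by simp

lemma smooth_continuous_iter: "smooth X \<Longrightarrow> continuous_on UNIV (\<lambda>(u, v). iter_gateaux X k v u)"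
  by (simp add: smooth_def)

lemma smooth_continuous_on_iter:
  assumes "smooth X" "continuous_on S f" "\<And>i. continuous_on S (\<lambda>x. g x i)"
  shows "continuous_on S (\<lambda>x. iter_gateaux X k (g x) (f x))"
  using continuous_on_compose2[OF smooth_continuous_iter[OF assms(1)], of S "\<lambda>x. (f x, g x)" k]
  by (simp add: assms continuous_on_Pair continuous_on_coordinatewise_then_product)

text \<open>No closed form of the iterated derivatives is required, only a class of joint functions
  of directions and point that contains the map, consists of continuous members and is stable under
  differentiation. The index records the order, because step \<open>k\<close> consumes the direction
  \<open>v k\<close>.\<close>

lemma smooth_coinduct:
  fixes P :: "nat \<Rightarrow> ((nat \<Rightarrow> 'a::{real_vector,topological_space}) \<Rightarrow> 'a \<Rightarrow> 'b::{real_vector,t2_space}) \<Rightarrow> bool"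
  assumes X: "P 0 (\<lambda>v. X)"
    and cont: "\<And>k T. P k T \<Longrightarrow> continuous_on UNIV (\<lambda>(u, v). T v u)"
    and deriv: "\<And>k T. P k T \<Longrightarrow> \<exists>T'. P (Suc k) T' \<and> (\<forall>v u. has_gateaux_deriv (T v) (T' v u) u (v k))"
  shows "smooth X"
proof -
  have P: "P k (iter_gateaux X k)" for k
  proof (induction k)
    case (Suc k)
    then obtain T' where T': "P (Suc k) T'" "\<And>v u. has_gateaux_deriv (iter_gateaux X k v) (T' v u) u (v k)"
      using deriv by blast
    have "iter_gateaux X (Suc k) = T'"
      by (intro ext) (simp add: gateaux_deriv_eqI[OF T'(2)])
    then show ?case using T'(1) by simp
  qed (simp add: X)
  show ?thesis
    unfolding smooth_def
  proof (intro allI conjI)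
    fix k v u
    obtain T' where "has_gateaux_deriv (iter_gateaux X k v) (T' v u) u (v k)"
      using deriv[OF P] by blast
    then show "gateaux_differentiable (iter_gateaux X k v) u (v k)"
      unfolding gateaux_differentiable_def has_gateaux_deriv_def by (rule curve_differentiableI)
    show "continuous_on UNIV (\<lambda>(u, v). iter_gateaux X k v u)"
      by (rule cont[OF P])
  qed
qed

text \<open>Differentiating first in direction \<open>d\<close> puts \<open>d\<close> in front of
  the sequence of directions, which is what \<open>case_nat\<close> does.\<close>

lemma iter_gateaux_gateaux_deriv:
  "iter_gateaux (\<lambda>u. gateaux_deriv X u d) k v = iter_gateaux X (Suc k) (case_nat d v)"
proof (induction k)
  case (Suc k)
  have "iter_gateaux X (Suc (Suc k)) (case_nat d v)
      = (\<lambda>u. gateaux_deriv (iter_gateaux X (Suc k) (case_nat d v)) u (v k))"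
    by simp
  with Suc show ?case
    by simp
qed simp

lemma smooth_gateaux_deriv:
  fixes X :: "'a::locally_convex_space \<Rightarrow> 'b::locally_convex_space"
  assumes "smooth X"
  shows "smooth (\<lambda>u. gateaux_deriv X u d)"
  unfolding smooth_def
proof (intro allI conjI)
  fix k v u
  show "gateaux_differentiable (iter_gateaux (\<lambda>u. gateaux_deriv X u d) k v) u (v k)"
    using smooth_iter_deriv[OF assms, of "Suc k" "case_nat d v" "v k" u]
    unfolding iter_gateaux_gateaux_deriv gateaux_differentiable_def has_gateaux_deriv_def
    by (rule curve_differentiableI)
  show "continuous_on UNIV (\<lambda>(u, v). iter_gateaux (\<lambda>u. gateaux_deriv X u d) k v u)"
    unfolding iter_gateaux_gateaux_deriv case_prod_unfold
  proof (rule smooth_continuous_on_iter[OF assms])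
    show "continuous_on UNIV (\<lambda>x. case_nat d (snd x) i)" for i
      using continuous_on_product_then_coordinatewise[OF continuous_on_snd[OF continuous_on_id]]
      by (cases i) (auto intro: continuous_on_const)
  qed (intro continuous_intros)
qed

lemma smooth_iter_gateaux:
  fixes X :: "'a::locally_convex_space \<Rightarrow> 'b::locally_convex_space"
  assumes "smooth X"
  shows "smooth (iter_gateaux X k v)"
  by (induction k) (auto intro: smooth_gateaux_deriv assms)

lemma smooth_gateaux_deriv_commute:
  fixes X :: "'a::locally_convex_space \<Rightarrow> 'b::locally_convex_space"
  assumes "smooth X"
  shows "gateaux_deriv (\<lambda>u. gateaux_deriv X u a) u b = gateaux_deriv (\<lambda>u. gateaux_deriv X u b) u a"
proof -
  have d1: "has_gateaux_deriv X (gateaux_deriv X u v) u v" for u v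
    by (rule smooth_has_gateaux_deriv[OF assms])
  have d2: "has_gateaux_deriv (\<lambda>u. gateaux_deriv X u v) (gateaux_deriv (\<lambda>u. gateaux_deriv X u v) u w) u w" for u v w
    by (rule smooth_has_gateaux_deriv[OF smooth_gateaux_deriv[OF assms]])
  have cont: "continuous_on UNIV (\<lambda>u. gateaux_deriv (\<lambda>u. gateaux_deriv X u v) u w)" for v w
    using smooth_continuous_on_iter[OF smooth_gateaux_deriv[OF smooth_gateaux_deriv[OF assms]],
        of UNIV "\<lambda>x. x" "\<lambda>_ _. 0" v w 0]
    by (simp add: continuous_on_id)
  show ?thesis
    using gateaux_deriv_commute_aux[OF d1 d2 d1 d2 cont cont] .
qed

text \<open>By induction the new direction is moved past the others, one exchange with the last
  direction at a time. This later interchanges a derivative in \<eta> with \<open>m\<close>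
  derivatives in \<epsilon>.\<close>

lemma gateaux_deriv_iter_commute:
  fixes X :: "'a::locally_convex_space \<Rightarrow> 'b::locally_convex_space"
  assumes "smooth X"
  shows "gateaux_deriv (iter_gateaux X k v) u d = iter_gateaux (\<lambda>u. gateaux_deriv X u d) k v u"
proof (induction k arbitrary: u)
  case (Suc k)
  have "gateaux_deriv (iter_gateaux X (Suc k) v) u d
      = gateaux_deriv (\<lambda>u. gateaux_deriv (iter_gateaux X k v) u d) u (v k)"
    by (simp add: smooth_gateaux_deriv_commute[OF smooth_iter_gateaux[OF assms]])
  then show ?case
    by (simp add: Suc.IH)
qed simp

text \<open>In the newest direction linearity is that of a continuous directional derivative. In an
  older direction the linearity identities already hold for the lower iterate at every point, and
  differentiating them along \<open>v k\<close> preserves them.\<close>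

lemma linear_iter_gateaux:
  fixes X :: "'a::locally_convex_space \<Rightarrow> 'b::locally_convex_space"
  assumes "smooth X" "i < k"
  shows "linear (\<lambda>q. iter_gateaux X k (v(i := q)) u)"
  using assms(2)
proof (induction k arbitrary: u)
  case (Suc k)
  show ?case
  proof (cases "i = k")
    case True
    have "continuous_on UNIV (\<lambda>(u, q). iter_gateaux X (Suc k) (v(k := q)) u)"
      unfolding case_prod_unfold
    proof (rule smooth_continuous_on_iter[OF assms(1)])
      show "continuous_on UNIV (\<lambda>x :: 'a \<times> 'a. (v(k := snd x)) i)" for i
        by (cases "i = k") (auto intro!: continuous_intros)
    qed (intro continuous_intros)
    then show ?thesis
      unfolding True by (rule gateaux_deriv_direction_linear[OF smooth_iter_deriv[OF assms(1)]])
  next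
    case False
    have lin: "linear (\<lambda>q. iter_gateaux X k (v(i := q)) u)" for u
      by (rule Suc.IH) (use False Suc.prems in simp)
    have deriv: "has_gateaux_deriv (iter_gateaux X k (v(i := q))) (iter_gateaux X (Suc k) (v(i := q)) u) u (v k)" for q u
      using smooth_iter_deriv[OF assms(1), of k "v(i := q)" "v k" u] False
      by (simp add: fun_upd_idem)
    show ?thesis
    proof (rule linearI)
      fix q r :: 'a
      have "has_gateaux_deriv (iter_gateaux X k (v(i := q + r)))
          (iter_gateaux X (Suc k) (v(i := q)) u + iter_gateaux X (Suc k) (v(i := r)) u) u (v k)"
        using has_curve_deriv_add[OF deriv[unfolded has_gateaux_deriv_def] deriv[unfolded has_gateaux_deriv_def]]
        unfolding has_gateaux_deriv_def by (simp only: linear_add[OF lin])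
      then show "iter_gateaux X (Suc k) (v(i := q + r)) u =
          iter_gateaux X (Suc k) (v(i := q)) u + iter_gateaux X (Suc k) (v(i := r)) u"
        by (rule has_gateaux_deriv_unique[OF deriv])
    next
      fix c and q :: 'a
      have "has_gateaux_deriv (iter_gateaux X k (v(i := c *\<^sub>R q)))
          (c *\<^sub>R iter_gateaux X (Suc k) (v(i := q)) u) u (v k)"
        using has_curve_deriv_scaleR_right[OF deriv[unfolded has_gateaux_deriv_def]]
        unfolding has_gateaux_deriv_def by (simp only: linear_scale[OF lin])
      then show "iter_gateaux X (Suc k) (v(i := c *\<^sub>R q)) u = c *\<^sub>R iter_gateaux X (Suc k) (v(i := q)) u"
        by (rule has_gateaux_deriv_unique[OF deriv])
    qed
  qed
qed simp

lemma linear_gateaux_deriv: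
  fixes X :: "'a::locally_convex_space \<Rightarrow> 'b::locally_convex_space"
  assumes "smooth X"
  shows "linear (gateaux_deriv X u)"
  using linear_iter_gateaux[OF assms, of 0 1 "\<lambda>_. 0" u] by simp

section \<open>Composition of smooth maps\<close>

text \<open>The product rule for a map that is linear in each of its first \<open>m\<close> slots
  and ignores the rest. The increment telescopes over the slots, and in each summand linearity turns
  the changed slot into a difference quotient.\<close>

lemma multilinear_deriv_tendsto:
  fixes M :: "(nat \<Rightarrow> 'a::locally_convex_space) \<Rightarrow> 'b::locally_convex_space"
  assumes cong: "\<And>v w. (\<And>i. i < m \<Longrightarrow> v i = w i) \<Longrightarrow> M v = M w"
    and lin: "\<And>i v. i < m \<Longrightarrow> linear (\<lambda>q. M (v(i := q)))"
    and cont: "continuous_on UNIV M"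
    and w: "\<And>i. has_curve_deriv (w i) (w' i) 0"
  shows "((\<lambda>h. (1 / h) *\<^sub>R (M (\<lambda>i. w i h) - M (\<lambda>i. w i 0)))
    \<longlongrightarrow> (\<Sum>i<m. M ((\<lambda>j. w j 0)(i := w' i)))) (at 0)"
proof -
  \<comment> \<open>The slots below \<open>k\<close> have already moved to parameter
    \<open>h\<close>, the others are still at \<open>0\<close>.\<close>
  define mix where "mix k h = (\<lambda>j. if j < k then w j h else w j 0)" for k h
  have step: "M (mix (Suc i) h) - M (mix i h) = M ((mix i h)(i := w i h - w i 0))" if "i < m" for i h
  proof -
    have "M (mix (Suc i) h) - M (mix i h) = M ((mix i h)(i := w i h)) - M ((mix i h)(i := w i 0))"
      by (intro arg_cong2[where f = minus] arg_cong[where f = M]) (auto simp: mix_def fun_eq_iff)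
    then show ?thesis
      by (simp add: linear_diff[OF lin[OF that]])
  qed
  have "(\<Sum>i<m. M ((mix i h)(i := diff_quotient (w i) 0 h)))
      = (1 / h) *\<^sub>R (M (\<lambda>i. w i h) - M (\<lambda>i. w i 0))" for h
  proof -
    have "(1 / h) *\<^sub>R (M (\<lambda>i. w i h) - M (\<lambda>i. w i 0)) = (1 / h) *\<^sub>R (M (mix m h) - M (mix 0 h))"
      by (intro arg_cong2[where f = scaleR] arg_cong2[where f = minus] cong refl) (auto simp: mix_def)
    also have "\<dots> = (\<Sum>i<m. (1 / h) *\<^sub>R (M (mix (Suc i) h) - M (mix i h)))"
      by (simp only: sum_lessThan_telescope[of "\<lambda>i. M (mix i h)"] flip: scaleR_sum_right)
    also have "\<dots> = (\<Sum>i<m. M ((mix i h)(i := diff_quotient (w i) 0 h)))"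
      by (intro sum.cong) (simp_all add: step linear_scale[OF lin] diff_quotient_def)
    finally show ?thesis ..
  qed
  moreover have "((\<lambda>h. \<Sum>i<m. M ((mix i h)(i := diff_quotient (w i) 0 h)))
      \<longlongrightarrow> (\<Sum>i<m. M ((\<lambda>j. w j 0)(i := w' i)))) (at 0)"
  proof (intro tendsto_sum continuous_on_tendsto_compose[OF cont] tendsto_funI)
    fix i j
    show "((\<lambda>h. ((mix i h)(i := diff_quotient (w i) 0 h)) j) \<longlongrightarrow> ((\<lambda>j. w j 0)(i := w' i)) j) (at 0)"
      using has_curve_deriv_tendsto[OF w[of j]] w[of i]
      by (cases "j < i") (auto simp: mix_def has_curve_deriv_def)
  qed auto
  ultimately show ?thesis
    by simp
qed

text \<open>Sums of the terms in the formula of Faa di Bruno; \<open>\<sigma> i\<close> selects the directions in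
  which the inner map \<open>f\<close> is differentiated for the \<open>i\<close>-th slot.\<close>

inductive faa_di_bruno_terms ::
    "('b::locally_convex_space \<Rightarrow> 'c::locally_convex_space) \<Rightarrow> ('a::locally_convex_space \<Rightarrow> 'b) \<Rightarrow>
      ((nat \<Rightarrow> 'a) \<Rightarrow> 'a \<Rightarrow> 'c) \<Rightarrow> bool" for g f where
  single: "faa_di_bruno_terms g f
    (\<lambda>v u. iter_gateaux g m (\<lambda>i. iter_gateaux f (n i) (\<lambda>j. v (\<sigma> i j)) u) (f u))"
| add: "faa_di_bruno_terms g f S \<Longrightarrow> faa_di_bruno_terms g f T \<Longrightarrow>
    faa_di_bruno_terms g f (\<lambda>v u. S v u + T v u)"

lemma faa_di_bruno_terms_continuous:
  fixes f :: "'a::locally_convex_space \<Rightarrow> 'b::locally_convex_space"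
    and g :: "'b \<Rightarrow> 'c::locally_convex_space"
  assumes "smooth g" "smooth f" "faa_di_bruno_terms g f T"
  shows "continuous_on UNIV (\<lambda>(u, v). T v u)"
  using assms(3)
proof induction
  case (single m n \<sigma>)
  have "continuous_on UNIV (\<lambda>x. f (fst x))"
    using smooth_continuous_on_iter[OF assms(2), of UNIV fst "\<lambda>_ _. 0" 0]
    by (simp add: continuous_on_fst continuous_on_id)
  then show ?case
    unfolding case_prod_unfold
    by (intro smooth_continuous_on_iter assms continuous_on_fst
        continuous_on_product_then_coordinatewise[OF continuous_on_snd] continuous_on_id)
next
  case (add S T)
  then show ?case
    unfolding case_prod_unfold by (intro continuous_on_add)
qed

text \<open>Differentiating one term has two effects: the outer derivative gains a slot filled with
  the derivative of \<open>f\<close> (\<open>T1\<close>), or one of the \<open>m\<close> existing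
  slots is differentiated once more (\<open>T2 i\<close>). Each result is again a single
  term.\<close>

lemma faa_di_bruno_terms_deriv:
  fixes f :: "'a::locally_convex_space \<Rightarrow> 'b::locally_convex_space"
    and g :: "'b \<Rightarrow> 'c::locally_convex_space"
  assumes "smooth g" "smooth f" "faa_di_bruno_terms g f T"
  shows "\<exists>T'. faa_di_bruno_terms g f T' \<and> (\<forall>v u. has_gateaux_deriv (T v) (T' v u) u (v k))"
  using assms(3)
proof induction
  case (single m n \<sigma>)
  define w where "w v u i = iter_gateaux f (n i) (\<lambda>j. v (\<sigma> i j)) u" for v u i
  define w' where "w' v u i = iter_gateaux f (Suc (n i)) ((\<lambda>j. v (\<sigma> i j))(n i := v k)) u" for v u i
  define T1 where "T1 v u = iter_gateaux g (Suc m) ((w v u)(m := gateaux_deriv f u (v k))) (f u)" for v u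
  define T2 where "T2 i v u = iter_gateaux g m ((w v u)(i := w' v u i)) (f u)" for i v u
  \<comment> \<open>Bookkeeping: the new slot \<open>m\<close> has order one and selects direction
    \<open>k\<close>; for \<open>T2 i\<close> below, \<open>k\<close> is instead appended at
    position \<open>n i\<close> of slot \<open>i\<close>.\<close>
  have "(w v u)(m := gateaux_deriv f u (v k))
      = (\<lambda>i. iter_gateaux f ((n(m := 1)) i) (\<lambda>j. v ((\<sigma>(m := \<lambda>_. k)) i j)) u)" for v u
    by (auto simp: fun_eq_iff w_def)
  then have T1: "faa_di_bruno_terms g f T1"
    unfolding T1_def by (simp only: faa_di_bruno_terms.single)
  have T2: "faa_di_bruno_terms g f (T2 i)" for i
  proof -
    have "(w v u)(i := w' v u i) = (\<lambda>l. iter_gateaux f ((n(i := Suc (n i))) l)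
        (\<lambda>j. v ((\<sigma>(i := (\<sigma> i)(n i := k))) l j)) u)" for v u
    proof -
      have "(\<lambda>j. v (\<sigma> i j))(n i := v k) = (\<lambda>j. v (((\<sigma> i)(n i := k)) j))"
        by auto
      then show ?thesis
        by (intro ext) (simp add: w_def w'_def del: iter_gateaux.simps)
    qed
    then show ?thesis
      unfolding T2_def by (simp only: faa_di_bruno_terms.single)
  qed
  have T: "faa_di_bruno_terms g f (\<lambda>v u. T1 v u + (\<Sum>i<r. T2 i v u))" for r
  proof (induction r)
    case (Suc r)
    have "(\<lambda>v u. T1 v u + (\<Sum>i<Suc r. T2 i v u)) = (\<lambda>v u. (T1 v u + (\<Sum>i<r. T2 i v u)) + T2 r v u)"
      by (simp add: add.assoc)
    then show ?case
      using faa_di_bruno_terms.add[OF Suc T2[of r]] by simp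
  qed (simp add: T1)
  have "has_gateaux_deriv (\<lambda>u. iter_gateaux g m (w v u) (f u)) (T1 v u + (\<Sum>i<m. T2 i v u)) u (v k)" for v u
  proof -
    let ?x = "\<lambda>h. u + h *\<^sub>R v k"
    let ?q = "diff_quotient (\<lambda>h. f (?x h)) 0"
    have w: "has_curve_deriv (\<lambda>h. w v (?x h) i) (w' v u i) 0" for i
      unfolding w_def w'_def by (rule smooth_iter_deriv[OF assms(2), unfolded has_gateaux_deriv_def])
    have f: "has_curve_deriv (\<lambda>h. f (?x h)) (gateaux_deriv f u (v k)) 0"
      by (rule smooth_has_gateaux_deriv[OF assms(2), unfolded has_gateaux_deriv_def])
    have cont_upd: "continuous_on UNIV (\<lambda>x :: (nat \<Rightarrow> 'b) \<times> 'b \<times> 'b. ((fst x)(m := snd (snd x))) i)" for i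
      using continuous_on_product_then_coordinatewise[OF continuous_on_fst[OF continuous_on_id]]
      by (cases "i = m") (auto intro!: continuous_on_snd continuous_on_id)
    have cont: "continuous_on UNIV (\<lambda>(p, y, q). iter_gateaux g (Suc m) (p(m := q)) y)"
      unfolding case_prod_unfold
      by (intro smooth_continuous_on_iter[OF assms(1)] cont_upd continuous_on_fst continuous_on_snd
          continuous_on_id)
    \<comment> \<open>The increment is split in two: first the outer base point returns from
      \<open>f (?x h)\<close> to \<open>f u\<close> while the slots stay at \<open>?x h\<close>,
      then the slots return to \<open>u\<close> with the base point fixed.\<close>
    have "((\<lambda>h. w v (?x h)) \<longlongrightarrow> w v u) (at 0)"
      using has_curve_deriv_tendsto[OF w] by (intro tendsto_funI) simp
    then have "((\<lambda>h. (1 / h) *\<^sub>R (iter_gateaux g m (w v (?x h)) (f u + h *\<^sub>R ?q h)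
        - iter_gateaux g m (w v (?x h)) (f u))) \<longlongrightarrow> T1 v u) (at 0)"
      unfolding T1_def
      by (rule partial_chain_tendsto[OF smooth_iter_deriv[OF assms(1)] cont _
          f[unfolded has_curve_deriv_def]])
    \<comment> \<open>For \<open>h \<noteq> 0\<close>, \<open>f u\<close> plus \<open>h\<close>
      times its difference quotient is \<open>f (?x h)\<close>.\<close>
    moreover have "\<forall>\<^sub>F h in at 0. (1 / h) *\<^sub>R (iter_gateaux g m (w v (?x h)) (f u + h *\<^sub>R ?q h)
        - iter_gateaux g m (w v (?x h)) (f u))
      = (1 / h) *\<^sub>R (iter_gateaux g m (w v (?x h)) (f (?x h)) - iter_gateaux g m (w v (?x h)) (f u))"
      by (auto simp: eventually_at_filter diff_quotient_def)
    ultimately have 1: "((\<lambda>h. (1 / h) *\<^sub>R (iter_gateaux g m (w v (?x h)) (f (?x h))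
        - iter_gateaux g m (w v (?x h)) (f u))) \<longlongrightarrow> T1 v u) (at 0)"
      by (rule Lim_transform_eventually)
    have 2: "((\<lambda>h. (1 / h) *\<^sub>R (iter_gateaux g m (\<lambda>i. w v (?x h) i) (f u)
        - iter_gateaux g m (\<lambda>i. w v (?x 0) i) (f u)))
      \<longlongrightarrow> (\<Sum>i<m. iter_gateaux g m ((\<lambda>j. w v (?x 0) j)(i := w' v u i)) (f u))) (at 0)"
    proof (rule multilinear_deriv_tendsto)
      show "linear (\<lambda>q. iter_gateaux g m (p(i := q)) (f u))" if "i < m" for i p
        by (rule linear_iter_gateaux[OF assms(1) that])
      show "continuous_on UNIV (\<lambda>p. iter_gateaux g m p (f u))"
        by (rule smooth_continuous_on_iter[OF assms(1)]) (auto intro!: continuous_intros)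
      show "iter_gateaux g m p (f u) = iter_gateaux g m q (f u)"
        if "\<And>i. i < m \<Longrightarrow> p i = q i" for p q
        by (simp only: iter_gateaux_cong[OF that])
    qed (rule w)
    show ?thesis
      using tendsto_add[OF 1 2]
      by (simp add: has_gateaux_deriv_iff_tendsto T2_def scaleR_diff_right)
  qed
  then show ?case
    using T[of m] unfolding w_def by (intro exI conjI allI)
next
  case (add S T)
  then obtain S' T' where "faa_di_bruno_terms g f S'" "faa_di_bruno_terms g f T'"
    "\<And>v u. has_gateaux_deriv (S v) (S' v u) u (v k)" "\<And>v u. has_gateaux_deriv (T v) (T' v u) u (v k)"
    by blast
  then show ?case
    unfolding has_gateaux_deriv_def
    by (intro exI[of _ "\<lambda>v u. S' v u + T' v u"] conjI allI faa_di_bruno_terms.add has_curve_deriv_add)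
qed

text \<open>The class of sums of Faa di Bruno terms is stable under differentiation in any
  direction, so it serves as an invariant independent of the order; the composite itself is the term
  with no slots.\<close>

theorem smooth_compose:
  fixes f :: "'a::locally_convex_space \<Rightarrow> 'b::locally_convex_space"
    and g :: "'b \<Rightarrow> 'c::locally_convex_space"
  assumes "smooth g" "smooth f"
  shows "smooth (\<lambda>x. g (f x))"
proof (rule smooth_coinduct[of "\<lambda>_. faa_di_bruno_terms g f"])
  show "faa_di_bruno_terms g f (\<lambda>v x. g (f x))"
    using faa_di_bruno_terms.single[of g f 0] by simp
next
  fix T assume T: "faa_di_bruno_terms g f T"
  show "continuous_on UNIV (\<lambda>(u, v). T v u)"
    by (rule faa_di_bruno_terms_continuous[OF assms T])
  show "\<exists>T'. faa_di_bruno_terms g f T' \<and> (\<forall>v u. has_gateaux_deriv (T v) (T' v u) u (v k))" for k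
    by (rule faa_di_bruno_terms_deriv[OF assms T])
qed

section \<open>Smoothness of linear maps, sums, pairs and products\<close>

lemma smooth_of_derivs:
  assumes "\<And>v u. D 0 v u = X u"
    and "\<And>k. continuous_on UNIV (\<lambda>(u, v). D k v u)"
    and "\<And>k v u. has_gateaux_deriv (D k v) (D (Suc k) v u) u (v k)"
  shows "smooth X"
proof (rule smooth_coinduct[of "\<lambda>k T. T = D k"])
  show "(\<lambda>v. X) = D 0"
    using assms(1) by (simp add: fun_eq_iff)
next
  fix k T
  assume "T = D k"
  then show "continuous_on UNIV (\<lambda>(u, v). T v u)"
    and "\<exists>T'. T' = D (Suc k) \<and> (\<forall>v u. has_gateaux_deriv (T v) (T' v u) u (v k))"
    using assms(2,3) by simp_all
qed

lemma smooth_iter_deriv':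
  assumes "smooth X"
  shows "has_gateaux_deriv (iter_gateaux X k v) (iter_gateaux X (Suc k) v u) u (v k)"
  using smooth_iter_deriv[OF assms, of k v "v k" u] unfolding fun_upd_triv .

lemma has_curve_deriv_affine:
  "has_curve_deriv (\<lambda>s. a + s *\<^sub>R b) b t"
proof -
  have "\<forall>\<^sub>F h in at 0. b = diff_quotient (\<lambda>s. a + s *\<^sub>R b) t h"
    by (auto simp: eventually_at_filter diff_quotient_def algebra_simps)
  then show ?thesis
    unfolding has_curve_deriv_def by (rule Lim_transform_eventually[OF tendsto_const])
qed

lemma has_curve_deriv_scaleR:
  fixes c :: "real \<Rightarrow> 'b::locally_convex_space"
  assumes "has_curve_deriv r r' t" "has_curve_deriv c c' t"
  shows "has_curve_deriv (\<lambda>s. r s *\<^sub>R c s) (r' *\<^sub>R c t + r t *\<^sub>R c') t"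
proof -
  have "((\<lambda>h. diff_quotient r t h *\<^sub>R c (t + h) + r t *\<^sub>R diff_quotient c t h)
      \<longlongrightarrow> r' *\<^sub>R c t + r t *\<^sub>R c') (at 0)"
    using assms(1) assms(2)[unfolded has_curve_deriv_def] has_curve_deriv_tendsto[OF assms(2)]
    by (intro tendsto_add lc_tendsto_scaleR tendsto_const) (simp_all add: has_curve_deriv_def)
  then show ?thesis
    unfolding has_curve_deriv_def
    by (rule Lim_transform_eventually) (simp add: diff_quotient_def algebra_simps)
qed

lemma smooth_linear:
  fixes f :: "'a::locally_convex_space \<Rightarrow> 'b::locally_convex_space"
  assumes "linear f" "continuous_on UNIV f"
  shows "smooth f"
proof (rule smooth_of_derivs)
  let ?D = "\<lambda>k v u. if k = 0 then f u else if k = (1::nat) then f (v (0::nat)) else 0"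
  fix k v u
  have "continuous_on UNIV (\<lambda>x :: 'a \<times> (nat \<Rightarrow> 'a). f (snd x 0))"
    by (rule continuous_on_compose2[OF assms(2)
          continuous_on_product_then_coordinatewise[OF continuous_on_snd[OF continuous_on_id]]]) simp
  moreover have "continuous_on UNIV (\<lambda>x :: 'a \<times> (nat \<Rightarrow> 'a). f (fst x))"
    by (rule continuous_on_compose2[OF assms(2) continuous_on_fst[OF continuous_on_id]]) simp
  ultimately show "continuous_on UNIV (\<lambda>(u, v). ?D k v u)"
    unfolding case_prod_unfold
    by (cases "k = 0"; cases "k = 1") (simp_all only: if_True if_False continuous_on_const simp_thms)
  have f: "has_gateaux_deriv f (f v) u v" for u v
    unfolding has_gateaux_deriv_def
    by (rule has_curve_deriv_linear[OF assms has_curve_deriv_affine])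
  consider "k = 0" | "k = 1" | "k > 1" by linarith
  then show "has_gateaux_deriv (?D k v) (?D (Suc k) v u) u (v k)"
  proof cases
    case 1
    then show ?thesis using f by simp
  qed (simp_all add: has_gateaux_deriv_def has_curve_deriv_const)
qed simp

lemma smooth_const: "smooth (\<lambda>_::'a::locally_convex_space. c::'b::locally_convex_space)"
  by (rule smooth_of_derivs[of "\<lambda>k v u. if k = 0 then c else 0"])
    (simp_all add: has_gateaux_deriv_def has_curve_deriv_const case_prod_unfold continuous_on_const)

lemma smooth_add:
  fixes f g :: "'a::locally_convex_space \<Rightarrow> 'b::locally_convex_space"
  assumes "smooth f" "smooth g"
  shows "smooth (\<lambda>x. f x + g x)"
proof (rule smooth_of_derivs)
  fix k v u
  let ?D = "\<lambda>k v u. iter_gateaux f k v u + iter_gateaux g k v u"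
  show "continuous_on UNIV (\<lambda>(u, v). ?D k v u)"
    using continuous_on_add[OF smooth_continuous_iter[OF assms(1)] smooth_continuous_iter[OF assms(2)], of k k]
    by (simp add: case_prod_unfold)
  show "has_gateaux_deriv (?D k v) (?D (Suc k) v u) u (v k)"
    using smooth_iter_deriv'[OF assms(1)] smooth_iter_deriv'[OF assms(2)]
    unfolding has_gateaux_deriv_def by (intro has_curve_deriv_add)
qed simp

lemma smooth_sum:
  fixes f :: "'i \<Rightarrow> 'a::locally_convex_space \<Rightarrow> 'b::locally_convex_space"
  assumes "\<And>i. i \<in> I \<Longrightarrow> smooth (f i)"
  shows "smooth (\<lambda>x. \<Sum>i\<in>I. f i x)"
  using assms
  by (induction I rule: infinite_finite_induct) (auto intro: smooth_const smooth_add)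

lemma smooth_Pair:
  fixes f :: "'a::locally_convex_space \<Rightarrow> 'b::locally_convex_space"
    and g :: "'a \<Rightarrow> 'c::locally_convex_space"
  assumes "smooth f" "smooth g"
  shows "smooth (\<lambda>x. (f x, g x))"
proof (rule smooth_of_derivs)
  fix k v u
  let ?D = "\<lambda>k v u. (iter_gateaux f k v u, iter_gateaux g k v u)"
  show "continuous_on UNIV (\<lambda>(u, v). ?D k v u)"
    using continuous_on_Pair[OF smooth_continuous_iter[OF assms(1)] smooth_continuous_iter[OF assms(2)], of k k]
    by (simp add: case_prod_unfold)
  show "has_gateaux_deriv (?D k v) (?D (Suc k) v u) u (v k)"
    using tendsto_Pair[OF smooth_iter_deriv'[OF assms(1), unfolded has_gateaux_deriv_iff_tendsto]
        smooth_iter_deriv'[OF assms(2), unfolded has_gateaux_deriv_iff_tendsto]]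
    by (simp add: has_gateaux_deriv_iff_tendsto del: iter_gateaux.simps)
qed simp

lemma smooth_vec_lambda:
  fixes f :: "'n::finite \<Rightarrow> 'a::locally_convex_space \<Rightarrow> 'b::locally_convex_space"
  assumes "\<And>i. smooth (f i)"
  shows "smooth (\<lambda>x. \<chi> i. f i x)"
proof (rule smooth_of_derivs)
  fix k v u
  let ?D = "\<lambda>k v u. \<chi> i. iter_gateaux (f i) k v u"
  show "continuous_on UNIV (\<lambda>(u, v). ?D k v u)"
    using smooth_continuous_iter[OF assms]
    unfolding case_prod_unfold continuous_on_def by (auto intro: tendsto_vec_lambda)
  have "((\<lambda>h. \<chi> i. (1 / h) *\<^sub>R (iter_gateaux (f i) k v (u + h *\<^sub>R v k) - iter_gateaux (f i) k v u))
      \<longlongrightarrow> ?D (Suc k) v u) (at 0)"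
    by (intro tendsto_vec_lambda smooth_iter_deriv'[OF assms, unfolded has_gateaux_deriv_iff_tendsto])
  also have "(\<lambda>h. \<chi> i. (1 / h) *\<^sub>R (iter_gateaux (f i) k v (u + h *\<^sub>R v k) - iter_gateaux (f i) k v u))
      = (\<lambda>h. (1 / h) *\<^sub>R (?D k v (u + h *\<^sub>R v k) - ?D k v u))"
    by (simp add: fun_eq_iff vec_eq_iff)
  finally show "has_gateaux_deriv (?D k v) (?D (Suc k) v u) u (v k)"
    unfolding has_gateaux_deriv_iff_tendsto .
qed simp

text \<open>Scalar multiplication is bilinear: its second derivative is constant in the point and
  all later ones vanish. Together with composition this gives smoothness of products without a
  Leibniz formula.\<close>

lemma smooth_scaleR_pair: "smooth (\<lambda>p :: real \<times> 'b::locally_convex_space. fst p *\<^sub>R snd p)"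
proof -
  define D where "D k v u = (if k = (0::nat) then fst u *\<^sub>R snd u
    else if k = 1 then fst (v 0) *\<^sub>R snd u + fst u *\<^sub>R snd (v 0)
    else if k = 2 then fst (v 0) *\<^sub>R snd (v 1) + fst (v 1) *\<^sub>R snd (v 0) else 0)"
    for k and v :: "nat \<Rightarrow> real \<times> 'b" and u
  have coord: "continuous_on UNIV (\<lambda>x :: (real \<times> 'b) \<times> (nat \<Rightarrow> real \<times> 'b). snd x i)" for i
    by (rule continuous_on_product_then_coordinatewise[OF continuous_on_snd[OF continuous_on_id]])
  have lin: "has_curve_deriv (\<lambda>\<epsilon>. fst (u + \<epsilon> *\<^sub>R v)) (fst v) 0"
    "has_curve_deriv (\<lambda>\<epsilon>. snd (u + \<epsilon> *\<^sub>R v)) (snd v) 0" for u v :: "real \<times> 'b"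
    using has_curve_deriv_affine[of "fst u" "fst v" 0] has_curve_deriv_affine[of "snd u" "snd v" 0]
    by simp_all
  show ?thesis
  proof (rule smooth_of_derivs)
    fix k v u
    show "continuous_on UNIV (\<lambda>(u, v). D k v u)"
      unfolding D_def case_prod_unfold
      by (cases "k = 0"; cases "k = 1"; cases "k = 2")
        (auto intro!: continuous_on_add lc_continuous_on_scaleR continuous_on_fst continuous_on_snd
          continuous_on_id coord continuous_on_const)
    consider "k = 0" | "k = 1" | "k = 2" | "k > 2" by linarith
    then show "has_gateaux_deriv (D k v) (D (Suc k) v u) u (v k)"
    proof cases
      case 1
      then show ?thesis
        using has_curve_deriv_scaleR[OF lin(1)[of u "v 0"] lin(2)[of u "v 0"]]
        by (simp add: D_def has_gateaux_deriv_def)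
    next
      case 2
      then show ?thesis
        using has_curve_deriv_add[OF has_curve_deriv_scaleR[OF has_curve_deriv_const lin(2)[of u "v 1"]]
            has_curve_deriv_scaleR[OF lin(1)[of u "v 1"] has_curve_deriv_const]]
        by (simp add: D_def has_gateaux_deriv_def)
    qed (simp_all add: D_def has_gateaux_deriv_def has_curve_deriv_const)
  qed (simp add: D_def)
qed

lemma smooth_scaleR:
  fixes f :: "'a::locally_convex_space \<Rightarrow> 'b::locally_convex_space"
  assumes "smooth r" "smooth f"
  shows "smooth (\<lambda>x. r x *\<^sub>R f x)"
  using smooth_compose[OF smooth_scaleR_pair smooth_Pair[OF assms]] by simp

lemma smooth_power_scaleR:
  fixes f :: "'a::locally_convex_space \<Rightarrow> 'b::locally_convex_space"
  assumes "smooth r" "smooth f"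
  shows "smooth (\<lambda>x. r x ^ n *\<^sub>R f x)"
proof (induction n)
  case (Suc n)
  from smooth_scaleR[OF assms(1) Suc] show ?case
    by simp
qed (simp add: assms)

lemma smooth_fst: "smooth (fst :: 'a::locally_convex_space \<times> 'b::locally_convex_space \<Rightarrow> 'a)"
  by (intro smooth_linear linear_fst continuous_on_fst continuous_on_id)

lemma smooth_snd: "smooth (snd :: 'a::locally_convex_space \<times> 'b::locally_convex_space \<Rightarrow> 'b)"
  by (intro smooth_linear linear_snd continuous_on_snd continuous_on_id)

lemma smooth_vec_nth: "smooth (\<lambda>x :: 'a::locally_convex_space ^ 'n::finite. x $ i)"
proof (rule smooth_linear)
  show "continuous_on UNIV (\<lambda>x :: 'a ^ 'n. x $ i)"
    unfolding continuous_on_def by (intro ballI tendsto_vec_nth tendsto_ident_at)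
qed (auto intro: linearI)

section \<open>Taylor coefficients of curves\<close>

text \<open>Phrased with iterates of \<open>curve_deriv\<close>, the operation occurring in
  \<open>perturbation_block\<close>, rather than as an instance of \<open>smooth\<close>.\<close>

definition smooth_curve :: "(real \<Rightarrow> 'b::{real_vector,t2_space}) \<Rightarrow> bool" where
  "smooth_curve c \<longleftrightarrow> (\<forall>k t. curve_differentiable ((curve_deriv ^^ k) c) t)"

lemma smooth_curve_has_deriv: "smooth_curve c \<Longrightarrow> has_curve_deriv c (curve_deriv c t) t"
  unfolding smooth_curve_def by (metis curve_differentiableD funpow_0)

lemma smooth_curve_deriv: "smooth_curve c \<Longrightarrow> smooth_curve (curve_deriv c)"
  unfolding smooth_curve_def by (metis funpow_simps_right(2) o_apply)

lemma smooth_curve_coinduct: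
  assumes "P c" "\<And>c. P c \<Longrightarrow> \<exists>c'. P c' \<and> (\<forall>t. has_curve_deriv c (c' t) t)"
  shows "smooth_curve c"
proof -
  have deriv: "P (curve_deriv c) \<and> (\<forall>t. curve_differentiable c t)" if c: "P c" for c
  proof -
    obtain c' where c': "P c'" "\<And>t. has_curve_deriv c (c' t) t"
      using assms(2)[OF c] by blast
    then have "curve_deriv c = c'"
      by (auto intro: curve_deriv_eqI)
    then show ?thesis
      using c' curve_differentiableI by blast
  qed
  have "P ((curve_deriv ^^ k) c)" for k
    by (induction k) (auto simp: assms(1) deriv)
  then show ?thesis
    using deriv by (auto simp: smooth_curve_def)
qed

lemma smooth_curve_add:
  fixes c d :: "real \<Rightarrow> 'b::locally_convex_space"
  assumes "smooth_curve c" "smooth_curve d"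
  shows "smooth_curve (\<lambda>t. c t + d t)"
proof (rule smooth_curve_coinduct[of "\<lambda>e. \<exists>c d. smooth_curve c \<and> smooth_curve d \<and> e = (\<lambda>t. c t + d t)"])
  fix e :: "real \<Rightarrow> 'b"
  assume "\<exists>c d. smooth_curve c \<and> smooth_curve d \<and> e = (\<lambda>t. c t + d t)"
  then obtain c d where "smooth_curve c" "smooth_curve d" and e: "e = (\<lambda>t. c t + d t)"
    by blast
  then show "\<exists>e'. (\<exists>c d. smooth_curve c \<and> smooth_curve d \<and> e' = (\<lambda>t. c t + d t)) \<and>
      (\<forall>t. has_curve_deriv e (e' t) t)"
    unfolding e
    by (intro exI[of _ "\<lambda>t. curve_deriv c t + curve_deriv d t"] exI[of _ "curve_deriv c"]
        exI[of _ "curve_deriv d"] conjI allI has_curve_deriv_add smooth_curve_has_deriv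
        smooth_curve_deriv refl)
qed (use assms in blast)

lemma smooth_curve_const: "smooth_curve (\<lambda>_. x)"
  by (rule smooth_curve_coinduct[of "\<lambda>c. \<exists>x. c = (\<lambda>_. x)"]) (auto intro: has_curve_deriv_const)

lemma smooth_curve_sum:
  fixes c :: "'i \<Rightarrow> real \<Rightarrow> 'b::locally_convex_space"
  assumes "\<And>i. i \<in> I \<Longrightarrow> smooth_curve (c i)"
  shows "smooth_curve (\<lambda>t. \<Sum>i\<in>I. c i t)"
  using assms
  by (induction I rule: infinite_finite_induct) (auto intro: smooth_curve_const smooth_curve_add)

text \<open>The bridge between the two notions of iterated derivative: along a line every
  differentiation uses the same direction \<open>v\<close>.\<close>

lemma curve_deriv_funpow_line:
  assumes "smooth X"
  shows "(curve_deriv ^^ k) (\<lambda>t. X (u + t *\<^sub>R v)) = (\<lambda>t. iter_gateaux X k (\<lambda>_. v) (u + t *\<^sub>R v))"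
proof (induction k)
  case (Suc k)
  have "has_curve_deriv (\<lambda>t. iter_gateaux X k (\<lambda>_. v) (u + t *\<^sub>R v))
      (iter_gateaux X (Suc k) (\<lambda>_. v) (u + t *\<^sub>R v)) t" for t
    using smooth_iter_deriv'[OF assms, of k "\<lambda>_. v" "u + t *\<^sub>R v"]
    unfolding has_gateaux_deriv_along .
  then show ?case
    by (simp add: Suc curve_deriv_eqI fun_eq_iff del: iter_gateaux.simps)
qed simp

lemma smooth_curve_line:
  assumes "smooth X"
  shows "smooth_curve (\<lambda>t. X (u + t *\<^sub>R v))"
  unfolding smooth_curve_def curve_deriv_funpow_line[OF assms]
proof (intro allI)
  fix k t
  show "curve_differentiable (\<lambda>t. iter_gateaux X k (\<lambda>_. v) (u + t *\<^sub>R v)) t"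
    by (rule curve_differentiableI[OF smooth_iter_deriv'[OF assms, of k "\<lambda>_. v" "u + t *\<^sub>R v",
          unfolded has_gateaux_deriv_along]])
qed

definition taylor_coeff :: "nat \<Rightarrow> (real \<Rightarrow> 'b::{real_vector,t2_space}) \<Rightarrow> 'b" where
  "taylor_coeff k c = (1 / fact k) *\<^sub>R (curve_deriv ^^ k) c 0"

lemma taylor_coeff_0 [simp]: "taylor_coeff 0 c = c 0"
  by (simp add: taylor_coeff_def)

text \<open>The factor is the quotient of consecutive factorials. Inductions on the order pass to
  the derivative through this identity and finally cancel \<open>Suc k\<close>.\<close>

lemma taylor_coeff_curve_deriv:
  "taylor_coeff k (curve_deriv c) = real (Suc k) *\<^sub>R taylor_coeff (Suc k) c"
  by (simp add: taylor_coeff_def funpow_swap1)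

lemma taylor_coeff_add:
  fixes c d :: "real \<Rightarrow> 'b::locally_convex_space"
  assumes "smooth_curve c" "smooth_curve d"
  shows "taylor_coeff k (\<lambda>t. c t + d t) = taylor_coeff k c + taylor_coeff k d"
  using assms
proof (induction k arbitrary: c d)
  case (Suc k)
  have "curve_deriv (\<lambda>t. c t + d t) = (\<lambda>t. curve_deriv c t + curve_deriv d t)"
    using Suc.prems
    by (intro ext curve_deriv_eqI has_curve_deriv_add smooth_curve_has_deriv)
  then have "real (Suc k) *\<^sub>R taylor_coeff (Suc k) (\<lambda>t. c t + d t)
      = real (Suc k) *\<^sub>R (taylor_coeff (Suc k) c + taylor_coeff (Suc k) d)"
    using Suc.IH[OF smooth_curve_deriv smooth_curve_deriv, OF Suc.prems]
    unfolding scaleR_add_right taylor_coeff_curve_deriv[symmetric] by simp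
  then show ?case
    by (rule scaleR_left_imp_eq[rotated]) simp
qed simp

lemma taylor_coeff_scaleR:
  fixes c :: "real \<Rightarrow> 'b::locally_convex_space"
  assumes "smooth_curve c"
  shows "taylor_coeff k (\<lambda>t. r *\<^sub>R c t) = r *\<^sub>R taylor_coeff k c"
  using assms
proof (induction k arbitrary: c)
  case (Suc k)
  have "curve_deriv (\<lambda>t. r *\<^sub>R c t) = (\<lambda>t. r *\<^sub>R curve_deriv c t)"
    using Suc.prems
    by (intro ext curve_deriv_eqI has_curve_deriv_scaleR_right smooth_curve_has_deriv)
  then have "real (Suc k) *\<^sub>R taylor_coeff (Suc k) (\<lambda>t. r *\<^sub>R c t)
      = real (Suc k) *\<^sub>R (r *\<^sub>R taylor_coeff (Suc k) c)"
    using Suc.IH[OF smooth_curve_deriv, OF Suc.prems]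
    unfolding scaleR_left_commute[of "real (Suc k)" r] taylor_coeff_curve_deriv[symmetric] by simp
  then show ?case
    by (rule scaleR_left_imp_eq[rotated]) simp
qed simp

lemma taylor_coeff_const: "taylor_coeff k (\<lambda>_. x) = (if k = 0 then x else 0)"
proof -
  have "(curve_deriv ^^ k) (\<lambda>_. x) = (\<lambda>_. if k = 0 then x else 0)"
  proof (induction k)
    case (Suc k)
    show ?case
      unfolding funpow.simps o_apply Suc
      by (intro ext curve_deriv_eqI) (simp add: has_curve_deriv_const)
  qed simp
  then show ?thesis
    by (simp add: taylor_coeff_def)
qed

lemma taylor_coeff_sum:
  fixes c :: "'i \<Rightarrow> real \<Rightarrow> 'b::locally_convex_space"
  assumes "\<And>i. i \<in> I \<Longrightarrow> smooth_curve (c i)"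
  shows "taylor_coeff k (\<lambda>t. \<Sum>i\<in>I. c i t) = (\<Sum>i\<in>I. taylor_coeff k (c i))"
  using assms
  by (induction I rule: infinite_finite_induct)
    (auto simp: taylor_coeff_const taylor_coeff_add smooth_curve_sum)

section \<open>Families of linear maps along a curve\<close>

text \<open>A path of operators differentiated pointwise. Joint continuity of each derivative in
  parameter and argument takes the place of continuity in an operator norm.\<close>

definition smooth_family ::
    "(real \<Rightarrow> 'b::locally_convex_space \<Rightarrow> 'c::locally_convex_space) \<Rightarrow> bool" where
  "smooth_family L \<longleftrightarrow> (\<forall>t. linear (L t)) \<and> (\<forall>x. smooth_curve (\<lambda>t. L t x)) \<and>
     (\<forall>m. continuous_on UNIV (\<lambda>(t, x). (curve_deriv ^^ m) (\<lambda>s. L s x) t))"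

lemma smooth_family_linear: "smooth_family L \<Longrightarrow> linear (L t)"
  by (simp add: smooth_family_def)

lemma smooth_family_curve: "smooth_family L \<Longrightarrow> smooth_curve (\<lambda>t. L t x)"
  by (simp add: smooth_family_def)

lemma smooth_family_deriv:
  assumes L: "smooth_family L"
  shows "smooth_family (\<lambda>t x. curve_deriv (\<lambda>s. L s x) t)"
  unfolding smooth_family_def
proof (intro conjI allI)
  note deriv = smooth_curve_has_deriv[OF smooth_family_curve[OF L]]
  show "linear (\<lambda>x. curve_deriv (\<lambda>s. L s x) t)" for t
  proof (rule linearI)
    show "curve_deriv (\<lambda>s. L s (x + y)) t = curve_deriv (\<lambda>s. L s x) t + curve_deriv (\<lambda>s. L s y) t" for x y
      unfolding linear_add[OF smooth_family_linear[OF L]]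
      by (intro curve_deriv_eqI has_curve_deriv_add deriv)
    show "curve_deriv (\<lambda>s. L s (r *\<^sub>R x)) t = r *\<^sub>R curve_deriv (\<lambda>s. L s x) t" for r x
      unfolding linear_scale[OF smooth_family_linear[OF L]]
      by (intro curve_deriv_eqI has_curve_deriv_scaleR_right deriv)
  qed
  show "smooth_curve (\<lambda>t. curve_deriv (\<lambda>s. L s x) t)" for x
    by (rule smooth_curve_deriv[OF smooth_family_curve[OF L]])
  have "continuous_on UNIV (\<lambda>(t, x). (curve_deriv ^^ Suc m) (\<lambda>s. L s x) t)" for m
    using L unfolding smooth_family_def by blast
  then show "continuous_on UNIV (\<lambda>(t, x). (curve_deriv ^^ m) (\<lambda>s. curve_deriv (\<lambda>s. L s x) s) t)" for m
    by (simp add: funpow_swap1)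
qed

text \<open>The quotient is split so that first only the operator moves, at the fixed argument
  \<open>x t\<close>, and then the moved operator acts on the quotient of \<open>x\<close>; joint
  continuity yields the limit of the second part.\<close>

lemma smooth_family_product_rule:
  assumes L: "smooth_family L" and x: "has_curve_deriv x x' t"
  shows "has_curve_deriv (\<lambda>s. L s (x s)) (curve_deriv (\<lambda>s. L s (x t)) t + L t x') t"
proof -
  have cont: "continuous_on UNIV (\<lambda>p. L (fst p) (snd p))"
    using L[unfolded smooth_family_def, THEN conjunct2, THEN conjunct2, rule_format, of 0]
    by (simp add: case_prod_unfold)
  have "((\<lambda>h. t + h) \<longlongrightarrow> t + 0) (at 0)"
    by (intro tendsto_intros)
  then have "((\<lambda>h. (t + h, diff_quotient x t h)) \<longlongrightarrow> (t, x')) (at 0)"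
    using x unfolding has_curve_deriv_def by (intro tendsto_Pair) simp_all
  from continuous_on_tendsto_compose[OF cont this]
  have "((\<lambda>h. L (t + h) (diff_quotient x t h)) \<longlongrightarrow> L t x') (at 0)"
    by simp
  moreover have "((\<lambda>h. diff_quotient (\<lambda>s. L s (x t)) t h) \<longlongrightarrow> curve_deriv (\<lambda>s. L s (x t)) t) (at 0)"
    using smooth_curve_has_deriv[OF smooth_family_curve[OF L]] unfolding has_curve_deriv_def .
  ultimately have "((\<lambda>h. diff_quotient (\<lambda>s. L s (x t)) t h + L (t + h) (diff_quotient x t h))
      \<longlongrightarrow> curve_deriv (\<lambda>s. L s (x t)) t + L t x') (at 0)"
    by (intro tendsto_add)
  also have "(\<lambda>h. diff_quotient (\<lambda>s. L s (x t)) t h + L (t + h) (diff_quotient x t h))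
      = diff_quotient (\<lambda>s. L s (x s)) t"
    by (simp add: fun_eq_iff diff_quotient_def linear_diff[OF smooth_family_linear[OF L]]
        linear_scale[OF smooth_family_linear[OF L]] algebra_simps)
  finally show ?thesis
    unfolding has_curve_deriv_def .
qed

text \<open>The product rule turns a curve \<open>L t (x t)\<close> into a sum of two such curves
  with different families and arguments. Closing under sums makes this an invariant for
  \<open>smooth_curve_coinduct\<close>.\<close>

inductive sum_closure :: "((real \<Rightarrow> 'b::plus) \<Rightarrow> bool) \<Rightarrow> (real \<Rightarrow> 'b) \<Rightarrow> bool" for P where
  base: "P c \<Longrightarrow> sum_closure P c"
| add: "sum_closure P c \<Longrightarrow> sum_closure P d \<Longrightarrow> sum_closure P (\<lambda>t. c t + d t)"

lemma smooth_curve_coinduct_sum: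
  fixes c :: "real \<Rightarrow> 'b::locally_convex_space"
  assumes "P c"
    and step: "\<And>c. P c \<Longrightarrow> \<exists>a b. P a \<and> P b \<and> (\<forall>t. has_curve_deriv c (a t + b t) t)"
  shows "smooth_curve c"
proof (rule smooth_curve_coinduct)
  show "sum_closure P c"
    using assms(1) by (rule sum_closure.base)
  show "\<exists>c'. sum_closure P c' \<and> (\<forall>t. has_curve_deriv c (c' t) t)" if "sum_closure P c" for c
    using that
  proof induction
    case (base c)
    then obtain a b where "P a" "P b" "\<And>t. has_curve_deriv c (a t + b t) t"
      using step by blast
    then show ?case
      by (intro exI[of _ "\<lambda>t. a t + b t"] conjI allI sum_closure.add sum_closure.base)
  next
    case (add c d)
    then obtain c' d' where "sum_closure P c'" "sum_closure P d'"
      "\<And>t. has_curve_deriv c (c' t) t" "\<And>t. has_curve_deriv d (d' t) t"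
      by blast
    then show ?case
      by (intro exI[of _ "\<lambda>t. c' t + d' t"] conjI allI sum_closure.add has_curve_deriv_add)
  qed
qed

lemma smooth_family_apply:
  fixes x :: "real \<Rightarrow> 'b::locally_convex_space"
  assumes "smooth_family L" "smooth_curve x"
  shows "smooth_curve (\<lambda>t. L t (x t))"
proof (rule smooth_curve_coinduct_sum[of
      "\<lambda>c. \<exists>L (x :: real \<Rightarrow> 'b). smooth_family L \<and> smooth_curve x \<and> c = (\<lambda>t. L t (x t))"])
  let ?P = "\<lambda>c. \<exists>L (x :: real \<Rightarrow> 'b). smooth_family L \<and> smooth_curve x \<and> c = (\<lambda>t. L t (x t))"
  fix c
  assume "?P c"
  then obtain L and x :: "real \<Rightarrow> 'b" where L: "smooth_family L" and x: "smooth_curve x"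
    and c: "c = (\<lambda>t. L t (x t))"
    by blast
  show "\<exists>a b. ?P a \<and> ?P b \<and> (\<forall>t. has_curve_deriv c (a t + b t) t)"
  proof (rule exI[of _ "\<lambda>t. curve_deriv (\<lambda>s. L s (x t)) t"],
      rule exI[of _ "\<lambda>t. L t (curve_deriv x t)"], rule conjI[OF _ conjI[OF _ allI]])
    show "?P (\<lambda>t. curve_deriv (\<lambda>s. L s (x t)) t)"
      by (rule exI[of _ "\<lambda>t y. curve_deriv (\<lambda>s. L s y) t"], rule exI[of _ x])
        (simp add: smooth_family_deriv[OF L] x)
    show "?P (\<lambda>t. L t (curve_deriv x t))"
      by (rule exI[of _ L], rule exI[of _ "curve_deriv x"]) (simp add: L smooth_curve_deriv[OF x])
    show "has_curve_deriv c (curve_deriv (\<lambda>s. L s (x t)) t + L t (curve_deriv x t)) t" for t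
      unfolding c by (rule smooth_family_product_rule[OF L smooth_curve_has_deriv[OF x]])
  qed
qed (use assms in blast)

text \<open>The Leibniz rule; normalising by factorials removes the binomial coefficients. In the
  induction the term with index \<open>i\<close> gets weight \<open>Suc k - i\<close> from
  differentiating the family and \<open>i\<close> from differentiating the argument, in total
  \<open>Suc k\<close>.\<close>

lemma taylor_coeff_family:
  assumes "smooth_family L" "smooth_curve x"
  shows "taylor_coeff k (\<lambda>t. L t (x t)) = (\<Sum>i\<le>k. taylor_coeff (k - i) (\<lambda>t. L t (taylor_coeff i x)))"
  using assms
proof (induction k arbitrary: L x)
  case (Suc k)
  define a where "a i = taylor_coeff (Suc k - i) (\<lambda>t. L t (taylor_coeff i x))" for i
  let ?L' = "\<lambda>t y. curve_deriv (\<lambda>s. L s y) t"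
  note L' = smooth_family_deriv[OF Suc.prems(1)] and x' = smooth_curve_deriv[OF Suc.prems(2)]
  have 1: "taylor_coeff (k - i) (\<lambda>t. ?L' t (taylor_coeff i x)) = real (Suc k - i) *\<^sub>R a i" if "i \<le> k" for i
    using that by (simp add: a_def Suc_diff_le taylor_coeff_curve_deriv)
  have 2: "taylor_coeff (k - i) (\<lambda>t. L t (taylor_coeff i (curve_deriv x))) = real (Suc i) *\<^sub>R a (Suc i)" for i
    unfolding taylor_coeff_curve_deriv linear_scale[OF smooth_family_linear[OF Suc.prems(1)]] a_def
    by (simp only: taylor_coeff_scaleR[OF smooth_family_curve[OF Suc.prems(1)]] diff_Suc_Suc)
  have "real (Suc k) *\<^sub>R taylor_coeff (Suc k) (\<lambda>t. L t (x t))
      = taylor_coeff k (\<lambda>t. ?L' t (x t) + L t (curve_deriv x t))"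
    unfolding taylor_coeff_curve_deriv[symmetric]
    by (intro arg_cong[where f = "taylor_coeff k"] ext curve_deriv_eqI[OF
        smooth_family_product_rule[OF Suc.prems(1) smooth_curve_has_deriv[OF Suc.prems(2)]]])
  also have "\<dots> = taylor_coeff k (\<lambda>t. ?L' t (x t)) + taylor_coeff k (\<lambda>t. L t (curve_deriv x t))"
    by (rule taylor_coeff_add[OF smooth_family_apply[OF L' Suc.prems(2)]
          smooth_family_apply[OF Suc.prems(1) x']])
  also have "\<dots> = (\<Sum>i\<le>k. real (Suc k - i) *\<^sub>R a i) + (\<Sum>i\<le>k. real (Suc i) *\<^sub>R a (Suc i))"
    unfolding Suc.IH[OF L' Suc.prems(2)] Suc.IH[OF Suc.prems(1) x'] 2
    by (intro arg_cong2[where f = plus] sum.cong refl 1) simp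
  \<comment> \<open>Both ranges are extended to \<open>Suc k\<close>: the first sum gains a last
    term and the shifted second sum a term at index \<open>0\<close>, each with weight zero.\<close>
  also have "(\<Sum>i\<le>k. real (Suc k - i) *\<^sub>R a i) = (\<Sum>i\<le>Suc k. real (Suc k - i) *\<^sub>R a i)"
    by simp
  also have "(\<Sum>i\<le>k. real (Suc i) *\<^sub>R a (Suc i)) = (\<Sum>i\<le>Suc k. real i *\<^sub>R a i)"
    by (subst sum.atMost_Suc_shift) simp
  also have "(\<Sum>i\<le>Suc k. real (Suc k - i) *\<^sub>R a i) + (\<Sum>i\<le>Suc k. real i *\<^sub>R a i)
      = (\<Sum>i\<le>Suc k. real (Suc k) *\<^sub>R a i)"
    unfolding sum.distrib[symmetric] scaleR_add_left[symmetric] of_nat_add[symmetric]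
    by (intro sum.cong) auto
  also have "\<dots> = real (Suc k) *\<^sub>R (\<Sum>i\<le>Suc k. a i)"
    by (rule scaleR_sum_right[symmetric])
  finally show ?case
    unfolding a_def by (rule scaleR_left_imp_eq[rotated]) simp
qed simp

text \<open>The Leibniz formula reads only the coefficients of the argument up to order
  \<open>k\<close>, so a curve may be exchanged for the polynomial curve with the same
  coefficients.\<close>

lemma taylor_coeff_family_cong:
  assumes "smooth_family L" "smooth_curve x" "smooth_curve y"
    and "\<And>i. i \<le> k \<Longrightarrow> taylor_coeff i x = taylor_coeff i y"
  shows "taylor_coeff k (\<lambda>t. L t (x t)) = taylor_coeff k (\<lambda>t. L t (y t))"
  by (simp add: taylor_coeff_family[OF assms(1,2)] taylor_coeff_family[OF assms(1,3)] assms(4))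

section \<open>Multiplication of curves by powers of the parameter\<close>

lemma curve_deriv_funpow_ident_scaleR:
  fixes x :: "'b::locally_convex_space"
  shows "(curve_deriv ^^ m) (\<lambda>s. s *\<^sub>R x) = (\<lambda>s. if m = 0 then s *\<^sub>R x else if m = 1 then x else 0)"
proof (induction m)
  case (Suc m)
  show ?case
    unfolding funpow.simps o_apply Suc
    using has_curve_deriv_affine[of 0 x]
    by (intro ext curve_deriv_eqI) (simp add: has_curve_deriv_const)
qed simp

lemma smooth_family_ident_scaleR: "smooth_family (\<lambda>t x. t *\<^sub>R (x :: 'b::locally_convex_space))"
  unfolding smooth_family_def
proof (intro conjI allI)
  show "linear ((*\<^sub>R) t :: 'b \<Rightarrow> 'b)" for t
    by (rule linear_scale_self)
  show "smooth_curve (\<lambda>t. t *\<^sub>R x)" for x :: 'b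
    using smooth_curve_line[OF smooth_linear[OF linear_ident continuous_on_id], of 0 x] by simp
  show "continuous_on UNIV (\<lambda>(t, x :: 'b). (curve_deriv ^^ m) (\<lambda>s. s *\<^sub>R x) t)" for m
    unfolding curve_deriv_funpow_ident_scaleR case_prod_unfold
    by (cases "m = 0"; cases "m = 1")
      (simp_all add: lc_continuous_on_scaleR continuous_on_fst continuous_on_snd continuous_on_id
        continuous_on_const)
qed

lemma taylor_coeff_ident_scaleR:
  fixes c :: "real \<Rightarrow> 'b::locally_convex_space"
  assumes "smooth_curve c"
  shows "taylor_coeff k (\<lambda>t. t *\<^sub>R c t) = (if k = 0 then 0 else taylor_coeff (k - 1) c)"
proof -
  have *: "taylor_coeff m (\<lambda>t. t *\<^sub>R x) = (if m = 1 then x else 0)" for m and x :: 'b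
    by (simp add: taylor_coeff_def curve_deriv_funpow_ident_scaleR)
  have "taylor_coeff k (\<lambda>t. t *\<^sub>R c t) = (\<Sum>i\<le>k. if k - i = 1 then taylor_coeff i c else 0)"
    unfolding taylor_coeff_family[OF smooth_family_ident_scaleR assms] * ..
  \<comment> \<open>For \<open>k = 0\<close> truncated subtraction makes \<open>k - 1\<close> equal
    to \<open>0\<close>, an index inside the range; the inner conditional removes that spurious
    term.\<close>
  also have "\<dots> = (\<Sum>i\<le>k. if i = k - 1 then if k = 0 then 0 else taylor_coeff i c else 0)"
    by (intro sum.cong) auto
  finally show ?thesis
    by simp
qed

lemma smooth_curve_power_scaleR:
  fixes c :: "real \<Rightarrow> 'b::locally_convex_space"
  assumes "smooth_curve c"
  shows "smooth_curve (\<lambda>t. t ^ l *\<^sub>R c t)"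
proof (induction l)
  case (Suc l)
  from smooth_family_apply[OF smooth_family_ident_scaleR Suc] show ?case
    by simp
qed (simp add: assms)

lemma taylor_coeff_power_scaleR:
  fixes c :: "real \<Rightarrow> 'b::locally_convex_space"
  assumes "smooth_curve c"
  shows "taylor_coeff k (\<lambda>t. t ^ l *\<^sub>R c t) = (if k < l then 0 else taylor_coeff (k - l) c)"
proof (induction l arbitrary: k)
  case (Suc l)
  have "taylor_coeff k (\<lambda>t. t ^ Suc l *\<^sub>R c t)
      = (if k = 0 then 0 else taylor_coeff (k - 1) (\<lambda>t. t ^ l *\<^sub>R c t))"
    using taylor_coeff_ident_scaleR[OF smooth_curve_power_scaleR[OF assms]] by simp
  then show ?case
    by (auto simp: Suc.IH)
qed simp

text \<open>Here \<open>\<iota>\<close> places the operator argument among the coordinates of one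
  smooth map and \<open>e\<close> is the parameter direction. Joint continuity of all parameter
  derivatives is then inherited from smoothness.\<close>

lemma smooth_family_of_smooth:
  fixes \<iota> :: "'b::locally_convex_space \<Rightarrow> 'a::locally_convex_space"
    and X :: "'a \<Rightarrow> 'c::locally_convex_space"
  assumes "smooth X" "continuous_on UNIV \<iota>" "\<And>t. linear (\<lambda>y. X (\<iota> y + t *\<^sub>R e))"
  shows "smooth_family (\<lambda>t y. X (\<iota> y + t *\<^sub>R e))"
  unfolding smooth_family_def
proof (intro conjI allI)
  fix m
  have "continuous_on UNIV (\<lambda>p. \<iota> (snd p) + fst p *\<^sub>R e)"
    by (intro continuous_on_add lc_continuous_on_scaleR continuous_on_fst continuous_on_id
        continuous_on_const continuous_on_compose2[OF assms(2) continuous_on_snd[OF continuous_on_id]]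
        subset_UNIV)
  then show "continuous_on UNIV (\<lambda>(t, y). (curve_deriv ^^ m) (\<lambda>s. X (\<iota> y + s *\<^sub>R e)) t)"
    unfolding curve_deriv_funpow_line[OF assms(1)] case_prod_unfold
    by (intro smooth_continuous_on_iter[OF assms(1)] continuous_on_const)
qed (use assms smooth_curve_line in auto)

section \<open>The perturbation operator\<close>

lemma perturbed_point_line:
  "perturbed_point ix (\<eta> + h *\<^sub>R \<theta>) \<epsilon> = perturbed_point ix \<eta> \<epsilon> + h *\<^sub>R perturbed_point ix \<theta> \<epsilon>"
  by (simp add: perturbed_point_def algebra_simps sum.distrib scaleR_sum_right)

lemma smooth_curve_perturbed_sum:
  fixes c :: "'n::finite \<Rightarrow> real \<Rightarrow> 'b::locally_convex_space"
  assumes "\<And>l. smooth_curve (c l)"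
  shows "smooth_curve (\<lambda>\<epsilon>. \<Sum>l\<in>UNIV. \<epsilon> ^ ix l *\<^sub>R c l \<epsilon>)"
  by (intro smooth_curve_sum smooth_curve_power_scaleR assms)

lemma taylor_coeff_perturbed_sum:
  fixes c :: "'n::finite \<Rightarrow> real \<Rightarrow> 'b::locally_convex_space"
  assumes "\<And>l. smooth_curve (c l)"
  shows "taylor_coeff k (\<lambda>\<epsilon>. \<Sum>l\<in>UNIV. \<epsilon> ^ ix l *\<^sub>R c l \<epsilon>)
    = (\<Sum>l\<in>UNIV. if k < ix l then 0 else taylor_coeff (k - ix l) (c l))"
  by (simp add: taylor_coeff_sum taylor_coeff_power_scaleR smooth_curve_power_scaleR assms)

lemma smooth_curve_perturbed_point:
  fixes \<eta> :: "'a::locally_convex_space ^ 'n::finite"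
  shows "smooth_curve (perturbed_point ix \<eta>)"
  unfolding perturbed_point_def[abs_def] by (rule smooth_curve_perturbed_sum[OF smooth_curve_const])

lemma taylor_coeff_perturbed_point:
  fixes \<eta> :: "'a::locally_convex_space ^ 'n::finite"
  assumes "inj ix"
  shows "taylor_coeff (ix l) (perturbed_point ix \<eta>) = \<eta> $ l"
proof -
  have "taylor_coeff (ix l) (perturbed_point ix \<eta>)
      = (\<Sum>j\<in>UNIV. if ix l < ix j then 0 else taylor_coeff (ix l - ix j) (\<lambda>_. \<eta> $ j))"
    unfolding perturbed_point_def[abs_def] by (rule taylor_coeff_perturbed_sum[OF smooth_curve_const])
  \<comment> \<open>Terms with larger \<open>ix j\<close> are cut off by the conditional; for
    smaller \<open>ix j\<close> a coefficient of positive order of a constant vanishes, and equality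
    forces \<open>j = l\<close> by injectivity.\<close>
  also have "\<dots> = (\<Sum>j\<in>UNIV. if j = l then \<eta> $ j else 0)"
    by (intro sum.cong) (auto simp: taylor_coeff_const dest: injD[OF assms])
  finally show ?thesis
    by simp
qed

lemma linear_perturbed_point:
  assumes "linear f"
  shows "f (perturbed_point ix W \<epsilon>) = (\<Sum>l\<in>UNIV. \<epsilon> ^ ix l *\<^sub>R f (W $ l))"
  by (simp add: perturbed_point_def linear_sum[OF assms] linear_scale[OF assms])

text \<open>The coordinate \<open>s\<close> moves the base point along \<open>y\<close>, so that the
  derivative in \<open>s\<close> at \<open>0\<close> is the operator derivative of \<Phi> in
  direction \<open>y\<close>. Differentiation in \<epsilon> is a Gateaux derivative in direction
  \<open>(0, 0, 0, 1, 0)\<close>.\<close>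

definition perturbed_operator ::
    "('n::finite \<Rightarrow> nat) \<Rightarrow> ('a::locally_convex_space \<Rightarrow> 'a \<Rightarrow> 'a) \<Rightarrow>
      ('a ^ 'n) \<times> 'a \<times> 'a \<times> real \<times> real \<Rightarrow> 'a" where
  "perturbed_operator ix \<Phi> = (\<lambda>(\<eta>, y, w, \<epsilon>, s). \<Phi> (perturbed_point ix \<eta> \<epsilon> + s *\<^sub>R y) w)"

lemma smooth_ident: "smooth (\<lambda>x :: 'a::locally_convex_space. x)"
  by (rule smooth_linear[OF linear_ident continuous_on_id])

lemma smooth_perturbed_operator:
  fixes \<Phi> :: "'a::locally_convex_space \<Rightarrow> 'a \<Rightarrow> 'a" and ix :: "'n::finite \<Rightarrow> nat"
  assumes "smooth (\<lambda>(u, w). \<Phi> u w)"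
  shows "smooth (perturbed_operator ix \<Phi>)"
proof -
  have "smooth (\<lambda>p :: ('a ^ 'n) \<times> 'a \<times> 'a \<times> real \<times> real.
      ((\<Sum>k\<in>UNIV. (fst (snd (snd (snd p))) ^ ix k) *\<^sub>R (fst p $ k)) + snd (snd (snd (snd p))) *\<^sub>R fst (snd p),
        fst (snd (snd p))))"
    by (intro smooth_Pair smooth_add smooth_sum smooth_scaleR smooth_power_scaleR
        smooth_compose[OF smooth_vec_nth] smooth_compose[OF smooth_fst] smooth_compose[OF smooth_snd]
        smooth_ident)
  from smooth_compose[OF assms this] show ?thesis
    by (simp add: perturbed_operator_def[abs_def] perturbed_point_def case_prod_unfold)
qed

section \<open>Operator fields along a perturbed point\<close>

context
  fixes \<Phi> :: "'a::locally_convex_space \<Rightarrow> 'a \<Rightarrow> 'a" and ix :: "'n::finite \<Rightarrow> nat"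
  assumes \<Phi>: "linear_operator_field \<Phi>"
begin

lemma linear_operator: "linear (\<Phi> u)"
  using \<Phi> by (simp add: linear_operator_field_def)

lemma smooth_operator: "smooth (\<lambda>u. \<Phi> u w)"
proof -
  have "smooth (\<lambda>(u, w). \<Phi> u w)"
    using \<Phi> by (simp add: linear_operator_field_def)
  from smooth_compose[OF this smooth_Pair[OF smooth_ident smooth_const]] show ?thesis
    by simp
qed

lemma smooth_perturbed: "smooth (perturbed_operator ix \<Phi>)"
  using \<Phi> by (simp add: linear_operator_field_def smooth_perturbed_operator)

lemma has_operator_deriv: "has_gateaux_deriv (\<lambda>x. \<Phi> x w) (operator_deriv \<Phi> u v w) u v"
  unfolding operator_deriv_def by (rule smooth_has_gateaux_deriv[OF smooth_operator])

lemma linear_operator_deriv_direction: "linear (\<lambda>v. operator_deriv \<Phi> u v w)"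
  unfolding operator_deriv_def by (rule linear_gateaux_deriv[OF smooth_operator])

lemma linear_operator_deriv: "linear (operator_deriv \<Phi> u v)"
proof (rule linearI)
  note deriv = has_operator_deriv[unfolded has_gateaux_deriv_def]
  show "operator_deriv \<Phi> u v (w + w') = operator_deriv \<Phi> u v w + operator_deriv \<Phi> u v w'" for w w'
    using has_curve_deriv_add[OF deriv[where u = u and v = v and w = w] deriv[where u = u and v = v and w = w']]
    by (intro has_gateaux_deriv_unique[OF has_operator_deriv])
      (simp add: has_gateaux_deriv_def linear_add[OF linear_operator])
  show "operator_deriv \<Phi> u v (r *\<^sub>R w) = r *\<^sub>R operator_deriv \<Phi> u v w" for r w
    using has_curve_deriv_scaleR_right[OF deriv[where u = u and v = v and w = w], of r]
    by (intro has_gateaux_deriv_unique[OF has_operator_deriv])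
      (simp add: has_gateaux_deriv_def linear_scale[OF linear_operator])
qed

lemma smooth_family_operator: "smooth_family (\<lambda>\<epsilon>. \<Phi> (perturbed_point ix \<eta> \<epsilon>))"
proof -
  have eq: "\<Phi> (perturbed_point ix \<eta> \<epsilon>) w
      = perturbed_operator ix \<Phi> ((\<eta>, 0, w, 0, 0) + \<epsilon> *\<^sub>R (0, 0, 0, 1, 0))" for \<epsilon> w
    by (simp add: perturbed_operator_def)
  show ?thesis
    unfolding eq[abs_def]
    by (intro smooth_family_of_smooth smooth_perturbed continuous_on_Pair continuous_on_const
        continuous_on_id) (simp add: perturbed_operator_def linear_operator)
qed

text \<open>The linear argument of this family is the direction \<open>y\<close>, with
  \<open>w\<close> fixed. It arises as the \<open>s\<close>-derivative of
  \<open>perturbed_operator\<close>, which is linear in \<open>y\<close> although the map itself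
  need not be.\<close>

lemma smooth_family_operator_deriv:
  "smooth_family (\<lambda>\<epsilon> y. operator_deriv \<Phi> (perturbed_point ix \<eta> \<epsilon>) y w)"
proof -
  have eq: "operator_deriv \<Phi> (perturbed_point ix \<eta> \<epsilon>) y w
      = gateaux_deriv (perturbed_operator ix \<Phi>) ((\<eta>, y, w, 0, 0) + \<epsilon> *\<^sub>R (0, 0, 0, 1, 0)) (0, 0, 0, 0, 1)"
    for \<epsilon> y
    by (simp add: operator_deriv_def gateaux_deriv_def perturbed_operator_def)
  have "linear (\<lambda>y. gateaux_deriv (perturbed_operator ix \<Phi>)
      ((\<eta>, y, w, 0, 0) + \<epsilon> *\<^sub>R (0, 0, 0, 1, 0)) (0, 0, 0, 0, 1))" for \<epsilon>
    unfolding eq[symmetric] by (rule linear_operator_deriv_direction)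
  then show ?thesis
    unfolding eq
    by (intro smooth_family_of_smooth smooth_gateaux_deriv smooth_perturbed continuous_on_Pair
        continuous_on_const continuous_on_id)
qed

text \<open>Two arguments vary here, while a family has one. The polynomial one is expanded by
  linearity into finitely many powers of \<epsilon> with constant \<open>w\<close>.\<close>

lemma smooth_curve_operator_deriv:
  assumes y: "smooth_curve y"
  shows "smooth_curve (\<lambda>\<epsilon>. operator_deriv \<Phi> (perturbed_point ix \<eta> \<epsilon>) (y \<epsilon>) (perturbed_point ix W \<epsilon>))"
  unfolding linear_perturbed_point[OF linear_operator_deriv]
  by (intro smooth_curve_perturbed_sum smooth_family_apply[OF smooth_family_operator_deriv] y)

text \<open>Exhibits the coefficient as a function of \<eta> and \<open>w\<close>: an iterated
  derivative of a smooth map, hence smooth and differentiable in \<eta>.\<close>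

lemma taylor_coeff_operator_iter_gateaux:
  "taylor_coeff m (\<lambda>\<epsilon>. \<Phi> (perturbed_point ix \<eta> \<epsilon>) w)
    = (1 / fact m) *\<^sub>R iter_gateaux (perturbed_operator ix \<Phi>) m (\<lambda>_. (0, 0, 0, 1, 0)) (\<eta>, 0, w, 0, 0)"
  using fun_cong[OF curve_deriv_funpow_line[OF smooth_perturbed,
        of m "(\<eta>, 0, w, 0, 0)" "(0, 0, 0, 1, 0)"], of 0]
  by (simp add: taylor_coeff_def perturbed_operator_def)

lemma perturbation_operator_nth:
  "perturbation_operator ix \<Phi> \<eta> W $ k
    = (\<Sum>l\<in>UNIV. if ix k < ix l then 0
        else taylor_coeff (ix k - ix l) (\<lambda>\<epsilon>. \<Phi> (perturbed_point ix \<eta> \<epsilon>) (W $ l)))"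
  by (simp add: perturbation_operator_def perturbation_block_def taylor_coeff_def cong: if_cong)

lemma linear_operator_field_perturbation: "linear_operator_field (perturbation_operator ix \<Phi>)"
  unfolding linear_operator_field_def
proof (intro conjI allI)
  fix \<eta> :: "'a ^ 'n"
  note lin = smooth_family_linear[OF smooth_family_operator]
    and curve = smooth_family_curve[OF smooth_family_operator]
  show "linear (perturbation_operator ix \<Phi> \<eta>)"
  proof (rule linearI)
    show "perturbation_operator ix \<Phi> \<eta> (V + W)
        = perturbation_operator ix \<Phi> \<eta> V + perturbation_operator ix \<Phi> \<eta> W" for V W
      by (simp add: vec_eq_iff perturbation_operator_nth linear_add[OF lin] taylor_coeff_add[OF curve curve]
          sum.distrib[symmetric] if_distrib cong: if_cong)
    show "perturbation_operator ix \<Phi> \<eta> (r *\<^sub>R W) = r *\<^sub>R perturbation_operator ix \<Phi> \<eta> W" for r W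
      by (simp add: vec_eq_iff perturbation_operator_nth linear_scale[OF lin] taylor_coeff_scaleR[OF curve]
          scaleR_sum_right if_distrib cong: if_cong)
  qed
next
  have "smooth (\<lambda>p. \<chi> k. \<Sum>l\<in>UNIV. if ix k < ix l then 0
      else taylor_coeff (ix k - ix l) (\<lambda>\<epsilon>. \<Phi> (perturbed_point ix (fst p) \<epsilon>) (snd p $ l)))"
  proof (intro smooth_vec_lambda smooth_sum)
    fix k l
    have "smooth (\<lambda>p. taylor_coeff (ix k - ix l)
        (\<lambda>\<epsilon>. \<Phi> (perturbed_point ix (fst p :: 'a ^ 'n) \<epsilon>) ((snd p :: 'a ^ 'n) $ l)))"
      unfolding taylor_coeff_operator_iter_gateaux
      by (intro smooth_scaleR smooth_const smooth_compose[OF smooth_iter_gateaux[OF smooth_perturbed]]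
          smooth_Pair smooth_fst smooth_compose[OF smooth_vec_nth] smooth_snd)
    then show "smooth (\<lambda>p. if ix k < ix l then 0 else taylor_coeff (ix k - ix l)
        (\<lambda>\<epsilon>. \<Phi> (perturbed_point ix (fst p :: 'a ^ 'n) \<epsilon>) ((snd p :: 'a ^ 'n) $ l)))"
      by (cases "ix k < ix l") (simp_all add: smooth_const)
  qed
  also have "(\<lambda>p. \<chi> k. \<Sum>l\<in>UNIV. if ix k < ix l then 0
      else taylor_coeff (ix k - ix l) (\<lambda>\<epsilon>. \<Phi> (perturbed_point ix (fst p) \<epsilon>) (snd p $ l)))
    = (\<lambda>(\<eta>, W). perturbation_operator ix \<Phi> \<eta> W)"
    by (simp add: fun_eq_iff vec_eq_iff perturbation_operator_nth cong: if_cong)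
  finally show "smooth (\<lambda>(\<eta>, W). perturbation_operator ix \<Phi> \<eta> W)" .
qed

text \<open>Differentiation in \<open>\<eta>\<close> commutes with that in \<open>\<epsilon>\<close>, by the symmetry of higher derivatives.\<close>

lemma taylor_coeff_operator_has_deriv:
  "has_gateaux_deriv (\<lambda>\<eta>. taylor_coeff m (\<lambda>\<epsilon>. \<Phi> (perturbed_point ix \<eta> \<epsilon>) w))
    (taylor_coeff m (\<lambda>\<epsilon>. operator_deriv \<Phi> (perturbed_point ix \<eta> \<epsilon>) (perturbed_point ix V \<epsilon>) w)) \<eta> V"
proof -
  \<comment> \<open>The direction \<open>?e\<close> advances \<epsilon>, and \<open>?d\<close> moves
    \<eta> along \<open>V\<close>.\<close>
  let ?\<Psi> = "perturbed_operator ix \<Phi>" and ?e = "(0, 0, 0, 1, 0) :: ('a ^ 'n) \<times> 'a \<times> 'a \<times> real \<times> real"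
    and ?p = "(\<eta>, 0, w, 0, 0) :: ('a ^ 'n) \<times> 'a \<times> 'a \<times> real \<times> real"
    and ?d = "(V, 0, 0, 0, 0) :: ('a ^ 'n) \<times> 'a \<times> 'a \<times> real \<times> real"
  have "gateaux_deriv ?\<Psi> (?p + \<epsilon> *\<^sub>R ?e) ?d
      = operator_deriv \<Phi> (perturbed_point ix \<eta> \<epsilon>) (perturbed_point ix V \<epsilon>) w" for \<epsilon>
    by (simp add: operator_deriv_def gateaux_deriv_def perturbed_operator_def perturbed_point_line)
  moreover have "(curve_deriv ^^ m) (\<lambda>\<epsilon>. gateaux_deriv ?\<Psi> (?p + \<epsilon> *\<^sub>R ?e) ?d)
      = (\<lambda>\<epsilon>. iter_gateaux (\<lambda>u. gateaux_deriv ?\<Psi> u ?d) m (\<lambda>_. ?e) (?p + \<epsilon> *\<^sub>R ?e))"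
    by (rule curve_deriv_funpow_line[OF smooth_gateaux_deriv[OF smooth_perturbed]])
  ultimately have "gateaux_deriv (iter_gateaux ?\<Psi> m (\<lambda>_. ?e)) ?p ?d
      = (curve_deriv ^^ m) (\<lambda>\<epsilon>. operator_deriv \<Phi> (perturbed_point ix \<eta> \<epsilon>) (perturbed_point ix V \<epsilon>) w) 0"
    by (simp only: gateaux_deriv_iter_commute[OF smooth_perturbed] scaleR_zero_left add_0_right)
  then have "has_curve_deriv (\<lambda>h. iter_gateaux ?\<Psi> m (\<lambda>_. ?e) (?p + h *\<^sub>R ?d))
      ((curve_deriv ^^ m) (\<lambda>\<epsilon>. operator_deriv \<Phi> (perturbed_point ix \<eta> \<epsilon>) (perturbed_point ix V \<epsilon>) w) 0) 0"
    using smooth_has_gateaux_deriv[OF smooth_iter_gateaux[OF smooth_perturbed], of m "\<lambda>_. ?e" ?p ?d]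
    unfolding has_gateaux_deriv_def by simp
  from has_curve_deriv_scaleR_right[OF this, of "1 / fact m"] show ?thesis
    unfolding has_gateaux_deriv_def taylor_coeff_operator_iter_gateaux
    by (simp add: taylor_coeff_def)
qed

lemma operator_deriv_perturbation_nth:
  "operator_deriv (perturbation_operator ix \<Phi>) \<eta> V W $ k
    = (\<Sum>l\<in>UNIV. if ix k < ix l then 0 else taylor_coeff (ix k - ix l)
        (\<lambda>\<epsilon>. operator_deriv \<Phi> (perturbed_point ix \<eta> \<epsilon>) (perturbed_point ix V \<epsilon>) (W $ l)))"
proof -
  let ?D = "\<lambda>k. \<Sum>l\<in>UNIV. if ix k < ix l then 0 else taylor_coeff (ix k - ix l)
      (\<lambda>\<epsilon>. operator_deriv \<Phi> (perturbed_point ix \<eta> \<epsilon>) (perturbed_point ix V \<epsilon>) (W $ l))"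
  have "has_curve_deriv (\<lambda>h. perturbation_operator ix \<Phi> (\<eta> + h *\<^sub>R V) W $ k) (?D k) 0" for k
    unfolding perturbation_operator_nth
    using taylor_coeff_operator_has_deriv
    by (intro has_curve_deriv_sum) (simp add: has_gateaux_deriv_def has_curve_deriv_const)
  then have "has_gateaux_deriv (\<lambda>x. perturbation_operator ix \<Phi> x W) (\<chi> k. ?D k) \<eta> V"
    unfolding has_gateaux_deriv_def has_curve_deriv_def
    by (intro vec_tendstoI) (simp add: diff_quotient_def[abs_def])
  then show ?thesis
    by (simp add: operator_deriv_def gateaux_deriv_eqI)
qed

end

section \<open>Action on Taylor expansions truncated at order N\<close>

context
  fixes \<Phi> :: "'a::locally_convex_space \<Rightarrow> 'a \<Rightarrow> 'a" and ix :: "'n::finite \<Rightarrow> nat" and N :: nat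
  assumes \<Phi>: "linear_operator_field \<Phi>" and ix: "bij_betw ix UNIV {0..N}"
begin

text \<open>Surjectivity of \<open>ix\<close> onto \<open>{0..N}\<close> supplies a component for
  every order up to \<open>N\<close>, and injectivity makes that component the coefficient.\<close>

lemma taylor_coeff_perturbed_point_eq:
  fixes V :: "'b::locally_convex_space ^ 'n"
  assumes "\<And>l. V $ l = taylor_coeff (ix l) y" "i \<le> N"
  shows "taylor_coeff i (perturbed_point ix V) = taylor_coeff i y"
proof -
  obtain l where "i = ix l"
    using ix assms(2) by (metis atLeastAtMost_iff bij_betw_imp_surj_on imageE le0)
  then show ?thesis
    using taylor_coeff_perturbed_point[of ix l V] ix assms(1) by (simp add: bij_betw_def)
qed

lemma ix_le: "ix k \<le> N"
  using ix bij_betwE by fastforce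

text \<open>The block product is the Taylor coefficient for the polynomial with coefficients
  \<open>Z\<close>. The order \<open>ix k\<close> is at most \<open>N\<close>, so the polynomial may
  be replaced by any curve \<open>z\<close> with these coefficients.\<close>

lemma perturbation_operator_taylor_coeff:
  assumes z: "smooth_curve z" and Z: "\<And>l. Z $ l = taylor_coeff (ix l) z"
  shows "perturbation_operator ix \<Phi> \<eta> Z $ k
    = taylor_coeff (ix k) (\<lambda>\<epsilon>. \<Phi> (perturbed_point ix \<eta> \<epsilon>) (z \<epsilon>))"
proof -
  note fam = smooth_family_operator[OF \<Phi>, of ix \<eta>]
  have "perturbation_operator ix \<Phi> \<eta> Z $ k
      = taylor_coeff (ix k) (\<lambda>\<epsilon>. \<Phi> (perturbed_point ix \<eta> \<epsilon>) (perturbed_point ix Z \<epsilon>))"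
    unfolding perturbation_operator_nth[OF \<Phi>] linear_perturbed_point[OF linear_operator[OF \<Phi>]]
    by (rule taylor_coeff_perturbed_sum[OF smooth_family_curve[OF fam], symmetric])
  also have "\<dots> = taylor_coeff (ix k) (\<lambda>\<epsilon>. \<Phi> (perturbed_point ix \<eta> \<epsilon>) (z \<epsilon>))"
    using le_trans[OF _ ix_le]
    by (intro taylor_coeff_family_cong[OF fam] smooth_curve_perturbed_point z
        taylor_coeff_perturbed_point_eq Z) blast
  finally show ?thesis .
qed

text \<open>Only the direction slot admits an arbitrary curve. This suffices for heredity: curves
  such as \<open>\<Phi> u w\<close>, in general not polynomial, enter the operator derivative only
  as directions.\<close>

lemma operator_deriv_perturbation_taylor_coeff:
  assumes y: "smooth_curve y" and V: "\<And>l. V $ l = taylor_coeff (ix l) y"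
  shows "operator_deriv (perturbation_operator ix \<Phi>) \<eta> V W $ k
    = taylor_coeff (ix k)
        (\<lambda>\<epsilon>. operator_deriv \<Phi> (perturbed_point ix \<eta> \<epsilon>) (y \<epsilon>) (perturbed_point ix W \<epsilon>))"
proof -
  note fam = smooth_family_operator_deriv[OF \<Phi>, of ix \<eta>]
  have "taylor_coeff (ix k - m) (\<lambda>\<epsilon>. operator_deriv \<Phi> (perturbed_point ix \<eta> \<epsilon>) (perturbed_point ix V \<epsilon>) w)
      = taylor_coeff (ix k - m) (\<lambda>\<epsilon>. operator_deriv \<Phi> (perturbed_point ix \<eta> \<epsilon>) (y \<epsilon>) w)" for m w
    using ix_le[of k]
    by (intro taylor_coeff_family_cong[OF fam] smooth_curve_perturbed_point y
        taylor_coeff_perturbed_point_eq V) linarith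
  then show ?thesis
    unfolding operator_deriv_perturbation_nth[OF \<Phi>] linear_perturbed_point[OF linear_operator_deriv[OF \<Phi>]]
    by (simp add: taylor_coeff_perturbed_sum[OF smooth_family_apply[OF fam y]] cong: if_cong)
qed

end

theorem theorem2p1:
  fixes \<Phi> :: "'a::locally_convex_space \<Rightarrow> 'a \<Rightarrow> 'a"
    and N :: nat
    and ix :: "'n::finite \<Rightarrow> nat"
  assumes "1 \<le> N"
    and "bij_betw ix UNIV {0..N}"
    and "hereditary \<Phi>"
  shows "hereditary (perturbation_operator ix \<Phi>)"
proof -
  have \<Phi>: "linear_operator_field \<Phi>"
    using assms(3) by (simp add: hereditary_def)
  \<comment> \<open>The heredity expression at \<open>u\<close> sees vector fields only through
    their values there, so constant fields give the identity for all vectors. Moving the negative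
    terms across leaves a form in which additivity of coefficients is enough.\<close>
  have her: "operator_deriv \<Phi> u (\<Phi> u v) w + \<Phi> u (operator_deriv \<Phi> u w v)
      = \<Phi> u (operator_deriv \<Phi> u v w) + operator_deriv \<Phi> u (\<Phi> u w) v" for u v w
    using assms(3)[unfolded hereditary_def, THEN conjunct2, rule_format,
        OF smooth_const[of v] smooth_const[of w], of u]
    by (simp add: algebra_simps add_eq_0_iff)
  note coeff = taylor_coeff_perturbed_point[OF bij_betw_imp_inj_on[OF assms(2)], symmetric]
    and pt = smooth_curve_perturbed_point
    and op_curve = smooth_family_apply[OF smooth_family_operator[OF \<Phi>]]
    and deriv_curve = smooth_curve_operator_deriv[OF \<Phi>]
    and op_coeff = perturbation_operator_taylor_coeff[OF \<Phi> assms(2)]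
    and deriv_coeff = operator_deriv_perturbation_taylor_coeff[OF \<Phi> assms(2)]
  let ?\<Phi> = "perturbation_operator ix \<Phi>"
  show ?thesis
    unfolding hereditary_def
  proof (intro conjI allI impI)
    show "linear_operator_field ?\<Phi>"
      by (rule linear_operator_field_perturbation[OF \<Phi>])
    fix K S :: "'a ^ 'n \<Rightarrow> 'a ^ 'n" and \<eta> :: "'a ^ 'n"
    let ?u = "perturbed_point ix \<eta>"
    define k where "k = perturbed_point ix (K \<eta>)"
    define s where "s = perturbed_point ix (S \<eta>)"
    have "operator_deriv ?\<Phi> \<eta> (?\<Phi> \<eta> (K \<eta>)) (S \<eta>) $ i + ?\<Phi> \<eta> (operator_deriv ?\<Phi> \<eta> (S \<eta>) (K \<eta>)) $ i
        = ?\<Phi> \<eta> (operator_deriv ?\<Phi> \<eta> (K \<eta>) (S \<eta>)) $ i + operator_deriv ?\<Phi> \<eta> (?\<Phi> \<eta> (S \<eta>)) (K \<eta>) $ i" for i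
    proof -
      \<comment> \<open>The inner value is a vector of coefficients of the curve
        \<open>\<Phi> u w\<close>, which is exactly what the rule for the outer factor expects; in
        \<open>2\<close> the roles are exchanged.\<close>
      have 1: "operator_deriv ?\<Phi> \<eta> (?\<Phi> \<eta> V) W $ i = taylor_coeff (ix i)
          (\<lambda>\<epsilon>. operator_deriv \<Phi> (?u \<epsilon>) (\<Phi> (?u \<epsilon>) (perturbed_point ix V \<epsilon>)) (perturbed_point ix W \<epsilon>))" for V W
        by (intro deriv_coeff op_curve pt op_coeff coeff)
      have 2: "?\<Phi> \<eta> (operator_deriv ?\<Phi> \<eta> V W) $ i = taylor_coeff (ix i)
          (\<lambda>\<epsilon>. \<Phi> (?u \<epsilon>) (operator_deriv \<Phi> (?u \<epsilon>) (perturbed_point ix V \<epsilon>) (perturbed_point ix W \<epsilon>)))" for V W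
        by (intro op_coeff deriv_curve pt deriv_coeff coeff)
      \<comment> \<open>Each side becomes the coefficient of one curve, and the two curves agree at
        every \<epsilon> by \<open>her\<close>.\<close>
      show ?thesis
        unfolding 1 2
        by (subst (1 2) taylor_coeff_add[symmetric])
          (intro op_curve deriv_curve pt arg_cong[where f = "taylor_coeff (ix i)"] ext her)+
    qed
    then show "operator_deriv ?\<Phi> \<eta> (?\<Phi> \<eta> (K \<eta>)) (S \<eta>) - ?\<Phi> \<eta> (operator_deriv ?\<Phi> \<eta> (K \<eta>) (S \<eta>))
        - operator_deriv ?\<Phi> \<eta> (?\<Phi> \<eta> (S \<eta>)) (K \<eta>) + ?\<Phi> \<eta> (operator_deriv ?\<Phi> \<eta> (S \<eta>) (K \<eta>)) = 0"
      by (simp add: vec_eq_iff algebra_simps)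
  qed
qed

end
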